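(* Let $z$ be an indeterminate. There is exactly one family of polynomials $c^{(k)}_\rho\in\mathbb{Q}[z]$, indexed by integers $k\ge 1$ and partitions $\rho$, such that $c^{(1)}_\rho=\delta_{\rho,(2)}$ for every $\rho$, $c^{(k)}_\emptyset=0$ for every $k\ge1$, and for every $k\ge 2$ and every partition $\rho$ the recurrence relations \[c^{(k)}_{\rho\cup (1)}=\sum_{r \ge 1} r\,m_r(\rho) \,c^{(k-1)}_{\rho\setminus (r) \cup(r+1)},\] \[\begin{aligned} \sum_{r \ge 1} r\,m_r(\rho) \,c^{(k)}_{\rho\setminus (r) \cup(r+1)}={}& (2-z)|\rho|\,c^{(k-1)}_\rho +(1-z)m_1(\rho)\,c^{(k-1)}_{\rho\setminus (1)}\\ &+\sum_{r,s \ge 1} rs\,m_r(\rho)(m_s(\rho)-\delta_{rs})\, c_{\rho \setminus (r,s)\cup (r+s+1)}^{(k-1)}\\ &+\sum_{r,s \ge 1} (r+s-1)\,m_{r+s-1}(\rho)\, c_{\rho \setminus (r+s-1)\cup (r,s)}^{(k-1)} \end{aligned}\] hold. For this family (whose members do not depend on $n$), for every $k\ge1$ and every $n\ge 1$, \[P_k(J_1,\ldots,J_n;z)=\sum_{|\rho|\le n}c^{(k)}_\rho \, \binom{n-|\overline{\rho}|}{m_1(\rho)} \, C_{\tilde{\rho}}\qquad\text{in } \mathbb{C}[z][S_n].\]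
   Context: $P_k(z)$, $k\ge1$, is the Hall-Littlewood symmetric function $P_\lambda(x;z)$ with parameter $z$ for the one-row partition $\lambda=(k)$; explicitly $P_k(x;z)=\sum_{|\lambda|=k}(1-z)^{l(\lambda)-1}m_\lambda(x)$ with $m_\lambda$ the monomial symmetric functions and $l(\lambda)$ the number of positive parts (so $P_k(0)=h_k$, $P_k(1)=p_k$). For $1\le i\le n$, the Jucys-Murphy element is $J_i=\sum_{1\le j<i}(j\,i)\in\mathbb{C}[S_n]$ (sum of transpositions; $J_1=0$); these commute. For a partition $\mu$ of $n$, $C_\mu$ is the sum in the group algebra of all permutations of cycle-type $\mu$. For a partition $\rho$: $|\rho|$ is its weight, $m_i(\rho)$ the multiplicity of the part $i$; $\overline{\rho}$ is $\rho$ with all parts $1$ erased; for $n\ge|\rho|$, $\tilde\rho=\rho\cup 1^{n-|\rho|}$. $\emptyset$ is the empty partition. $\rho\setminus(p)\cup(q)$ denotes the partition obtained from $\rho$ by removing one part $p$ and adding one part $q$ (similarly $\rho\setminus(r,s)\cup(q)$, $\rho\setminus(p)\cup(r,s)$, $\rho\cup(1)$, $\rho\setminus(1)$); terms in which such a partition does not exist are $0$. Sums over $r,s\ge1$ are over ordered pairs. *)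

theory Defs
  imports
    "HOL-Combinatorics.Perm"
    "HOL-Library.FuncSet"
    "HOL-Library.Multiset"
    "HOL-Library.Poly_Mapping"
    "HOL-Computational_Algebra.Polynomial"
begin

text \<open>
  \<^typ>\<open>'a \<Rightarrow>\<^sub>0 'b\<close> multiplies by convolution along the addition of \<^typ>\<open>'a\<close>. Reading the
  composition of permutations additively turns \<^typ>\<open>'a perm \<Rightarrow>\<^sub>0 'b\<close> into the group algebra,
  over \<^typ>\<open>'b\<close>, of the group of finitary permutations of \<^typ>\<open>'a\<close>.
\<close>

instantiation perm :: (type) monoid_add
begin

definition zero_perm :: "'a perm" where "zero_perm = 1"

definition plus_perm :: "'a perm \<Rightarrow> 'a perm \<Rightarrow> 'a perm" where "plus_perm p q = p * q"

instance
  by standard (simp_all add: zero_perm_def plus_perm_def mult.assoc)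

end

type_synonym 'b sym_algebra = "nat perm \<Rightarrow>\<^sub>0 'b"

definition group_elem :: "nat perm \<Rightarrow> ('b::zero_neq_one) sym_algebra"
  where "group_elem p = Poly_Mapping.single p 1"

definition scalar :: "('b::zero) \<Rightarrow> 'b sym_algebra"
  where "scalar a = Poly_Mapping.single 0 a"

text \<open>
  The group \<open>S\<^sub>n\<close> consists of the permutations of \<^typ>\<open>nat\<close> moving only elements of \<open>{1..n}\<close>,
  so that the algebras of all \<open>S\<^sub>n\<close> are subalgebras of \<^typ>\<open>'b sym_algebra\<close>.
\<close>

definition symm_group :: "nat \<Rightarrow> nat perm set"
  where "symm_group n = {p. affected p \<subseteq> {1..n}}"

text \<open>Partitions are the multisets of their (positive) parts.\<close>

definition partitions :: "nat multiset set"
  where "partitions = {\<rho>. 0 \<notin># \<rho>}"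

definition cycle_type :: "nat \<Rightarrow> nat perm \<Rightarrow> nat multiset"
  where "cycle_type n p = image_mset card (mset_set (orbit p ` {1..n}))"

definition class_sum :: "nat \<Rightarrow> nat multiset \<Rightarrow> ('b::comm_ring_1) sym_algebra"
  where "class_sum n \<mu> = (\<Sum>p | p \<in> symm_group n \<and> cycle_type n p = \<mu>. group_elem p)"

definition jucys_murphy :: "nat \<Rightarrow> ('b::comm_ring_1) sym_algebra"
  where "jucys_murphy i = (\<Sum>j\<in>{1..<i}. group_elem (Perm.swap j i))"

text \<open>
  The monomial symmetric polynomial, evaluated at a list of ring elements: the sum runs over the
  distinct exponent vectors whose nonzero entries are the parts of \<open>\<mu>\<close>. The products are taken in
  the order of the list, which is immaterial when its members commute.
\<close>

definition monomial_sym :: "nat multiset \<Rightarrow> ('a::ring_1) list \<Rightarrow> 'a"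
  where "monomial_sym \<mu> xs =
    (\<Sum>\<alpha> | length \<alpha> = length xs \<and> filter_mset (\<lambda>a. a \<noteq> 0) (mset \<alpha>) = \<mu>.
      prod_list (map2 (^) xs \<alpha>))"

text \<open>The Hall-Littlewood polynomial of the one-row partition \<open>(k)\<close>, for \<open>k \<ge> 1\<close>.\<close>

definition hall_littlewood_row :: "nat \<Rightarrow> ('a::ring_1) list \<Rightarrow> 'a \<Rightarrow> 'a"
  where "hall_littlewood_row k xs t =
    (\<Sum>\<mu> | \<mu> \<in> partitions \<and> \<Sum>\<^sub># \<mu> = k. (1 - t) ^ (size \<mu> - 1) * monomial_sym \<mu> xs)"

text \<open>
  In the recurrences the index \<open>r\<close> (resp. the pair \<open>r, s\<close>) may be bounded by \<open>|\<rho>|\<close>: for larger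
  values the multiplicity in the summand vanishes. The same factor vanishes whenever the partition
  to be modified lacks the parts to be removed. The polynomial variable is \<^term>\<open>[:0, 1:]\<close>.
\<close>

definition raise_sum :: "(nat multiset \<Rightarrow> rat poly) \<Rightarrow> nat multiset \<Rightarrow> rat poly"
  where "raise_sum f \<rho> =
    (\<Sum>r\<in>{1..\<Sum>\<^sub># \<rho>}. of_nat (r * count \<rho> r) * f (\<rho> - {#r#} + {#r + 1#}))"

definition join_sum :: "(nat multiset \<Rightarrow> rat poly) \<Rightarrow> nat multiset \<Rightarrow> rat poly"
  where "join_sum f \<rho> =
    (\<Sum>r\<in>{1..\<Sum>\<^sub># \<rho>}. \<Sum>s\<in>{1..\<Sum>\<^sub># \<rho>}.
      of_nat (r * s) * of_nat (count \<rho> r) * (of_nat (count \<rho> s) - (if r = s then 1 else 0))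
        * f (\<rho> - {#r, s#} + {#r + s + 1#}))"

definition cut_sum :: "(nat multiset \<Rightarrow> rat poly) \<Rightarrow> nat multiset \<Rightarrow> rat poly"
  where "cut_sum f \<rho> =
    (\<Sum>r\<in>{1..\<Sum>\<^sub># \<rho>}. \<Sum>s\<in>{1..\<Sum>\<^sub># \<rho>}.
      of_nat ((r + s - 1) * count \<rho> (r + s - 1)) * f (\<rho> - {#r + s - 1#} + {#r, s#}))"

definition content_recurrences :: "(nat \<Rightarrow> nat multiset \<Rightarrow> rat poly) \<Rightarrow> bool"
  where "content_recurrences c \<longleftrightarrow>
    (\<forall>\<rho>\<in>partitions. c 1 \<rho> = (if \<rho> = {#2#} then 1 else 0)) \<and>
    (\<forall>k\<ge>1. c k {#} = 0) \<and>
    (\<forall>k\<ge>2. \<forall>\<rho>\<in>partitions.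
      c k (\<rho> + {#1#}) = raise_sum (c (k - 1)) \<rho> \<and>
      raise_sum (c k) \<rho> =
        (2 - [:0, 1:]) * of_nat (\<Sum>\<^sub># \<rho>) * c (k - 1) \<rho>
        + (1 - [:0, 1:]) * of_nat (count \<rho> 1) * c (k - 1) (\<rho> - {#1#})
        + join_sum (c (k - 1)) \<rho>
        + cut_sum (c (k - 1)) \<rho>)"

text \<open>
  A family indexed by \<open>k \<ge> 1\<close> and partitions is an extensional function, so that it is determined by
  its values on these indices.
\<close>

definition content_families :: "(nat \<Rightarrow> nat multiset \<Rightarrow> rat poly) set"
  where "content_families = {c \<in> {1..} \<rightarrow>\<^sub>E (partitions \<rightarrow>\<^sub>E UNIV). content_recurrences c}"

end

theory Submission
  imports Defs
begin

text \<open>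
  The number \<open>n\<close> enters the class expansion only through binomial coefficients, and these count
  sets. This is made precise by the partial permutations of Ivanov and Kerov: pairs \<open>(d, g)\<close> of a
  finite set and a permutation, multiplied by \<open>(d, g) (e, h) = (d \<union> e, g h)\<close>. Lifting a
  transposition \<open>(j i)\<close> to \<open>({j, i}, (j i))\<close> lifts the Jucys-Murphy elements, and hence
  \<open>P\<^sub>k(J\<^sub>1, \<dots>, J\<^sub>n; z)\<close>, to the algebra of partial permutations. The coefficient of \<open>(d, g)\<close> in the
  lifted polynomial is the same for all \<open>n\<close> with \<open>d \<subseteq> {1..n}\<close>, and by symmetry it depends only on the
  cycle type \<open>\<rho>\<close> of \<open>g\<close> on \<open>d\<close>: this is \<open>c\<^sup>(\<^sup>k\<^sup>)\<^sub>\<rho>\<close>, here \<open>class_coefficient\<close>. Forgetting \<open>d\<close> is a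
  homomorphism to the group algebra, so the coefficient of \<open>g\<close> in \<open>P\<^sub>k(J\<^sub>1, \<dots>, J\<^sub>n; z)\<close> is the sum of
  the \<open>c\<^sup>(\<^sup>k\<^sup>)\<^sub>\<rho>\<close> over all \<open>d \<subseteq> {1..n}\<close> that contain the points moved by \<open>g\<close>. The number of those \<open>d\<close>
  on which \<open>g\<close> has type \<open>\<rho>\<close> is the binomial coefficient of the theorem
  (\<open>card_supports_of_type\<close>, \<open>hall_littlewood_row_expansion\<close>).

  For the symmetry it is enough to conjugate by an adjacent transposition \<open>s\<close>, which sends the lifted
  elements \<open>x = X\<^sub>i\<close> and \<open>y = X\<^sub>i\<^sub>+\<^sub>1\<close> to \<open>y - s\<close> and \<open>x + s\<close> and fixes the other ones. As \<open>x\<close> and \<open>y\<close>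
  commute, \<open>x + y\<close> and \<open>y x\<close> are fixed as well, and \<open>P\<^sub>k\<close> depends on \<open>x\<close> and \<open>y\<close> through these two
  only (\<open>hall_littlewood_row_exchange\<close>).

  The recurrences come from the product formula
  \<open>1 + (1 - z) \<Sum>\<^sub>k P\<^sub>k u\<^sup>k = \<Prod>\<^sub>i (1 - z u x\<^sub>i) / (1 - u x\<^sub>i)\<close>, which gives
  \<open>P\<^sub>k(xs, x) = P\<^sub>k(xs) + (P\<^sub>k\<^sub>-\<^sub>1(xs, x) - z P\<^sub>k\<^sub>-\<^sub>1(xs)) x\<close> for \<open>k \<ge> 2\<close>
  (\<open>hall_littlewood_row_Suc_snoc\<close>). Let \<open>x\<close> be the lifted Jucys-Murphy element of the largest element
  \<open>a\<close> of \<open>d\<close>. Comparing coefficients of \<open>(d, g)\<close> leads to the partial permutations \<open>(e, g (j a))\<close>, where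
  \<open>j\<close> is another element of \<open>d\<close> and \<open>e\<close> is \<open>d\<close> or arises from it by dropping \<open>j\<close>, \<open>a\<close> or both. By symmetry \<open>a\<close>
  may be any element of \<open>d\<close>. Multiplication by \<open>(j a)\<close> either merges the cycle of \<open>a\<close> with another one or
  cuts it in two. So for each part \<open>p\<close> of \<open>\<rho>\<close>, namely the length of the cycle of \<open>a\<close>, the polynomial
  \<open>c\<^sup>(\<^sup>k\<^sup>)\<^sub>\<rho>\<close> is expressed by polynomials \<open>c\<^sup>(\<^sup>k\<^sup>-\<^sup>1\<^sup>)\<^sub>\<sigma>\<close> (\<open>class_coefficient_Suc\<close>). The case \<open>p = 1\<close> is the first
  recurrence. The second one is the sum over \<open>r\<close>, with weights \<open>r m\<^sub>r(\<rho>)\<close>, of the instances with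
  \<open>\<rho> \<setminus> (r) \<union> (r + 1)\<close> for \<open>\<rho>\<close> and \<open>p = r + 1\<close>.

  Conversely the recurrences determine the family, by induction on \<open>k\<close>. The first one settles the
  partitions with a part \<open>1\<close>. If \<open>p + 1\<close> is a part of \<open>\<rho>\<close>, then the left-hand side of the second one at
  \<open>\<rho> \<setminus> (p + 1) \<union> (p)\<close> contains \<open>c\<^sup>(\<^sup>k\<^sup>)\<^sub>\<rho>\<close> with a nonzero factor, and all its other terms belong to
  partitions with a part \<open>p\<close>, which reduces \<open>p + 1\<close> to \<open>p\<close> (\<open>content_recurrences_unique\<close>).
\<close>

unbundle permutation_syntax

section \<open>Cycle types on finite sets\<close>

definition cycle_type_on :: "'a set \<Rightarrow> 'a perm \<Rightarrow> nat multiset"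
  where "cycle_type_on D g = image_mset card (mset_set (orbit g ` D))"

definition union_of_orbits :: "'a perm \<Rightarrow> 'a set \<Rightarrow> bool"
  where "union_of_orbits g D \<longleftrightarrow> (\<forall>x\<in>D. orbit g x \<subseteq> D)"

lemma cycle_type_eq: "cycle_type n g = cycle_type_on {1..n} g"
  by (simp add: cycle_type_def cycle_type_on_def)

lemma orbit_eq_iff: "orbit g x = orbit g y \<longleftrightarrow> x \<in> orbit g y"
  by (metis in_orbit_self orbit_equiv)

lemma orbit_sym: "x \<in> orbit g y \<longleftrightarrow> y \<in> orbit g x"
  by (metis in_orbit_self orbit_equiv)

lemma union_of_orbits_affected:
  assumes "affected g \<subseteq> D"
  shows "union_of_orbits g D"
  unfolding union_of_orbits_def
proof
  fix x assume "x \<in> D"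
  show "orbit g x \<subseteq> D"
  proof (cases "x \<in> affected g")
    case True
    then show ?thesis using orbit_subset_eq_affected[OF True] assms by blast
  next
    case False
    then show ?thesis using \<open>x \<in> D\<close> by (simp add: not_in_affected_iff_orbit_eq_singleton)
  qed
qed

lemma union_of_orbits_Diff:
  assumes "union_of_orbits g D"
  shows "union_of_orbits g (D - orbit g a)"
proof -
  have "y \<notin> orbit g a" if "y \<in> orbit g x" "x \<notin> orbit g a" for x y
    using that orbit_sym orbit_equiv by metis
  then show ?thesis using assms unfolding union_of_orbits_def by blast
qed

lemma cycle_type_on_remove_orbit:
  assumes "finite D" "union_of_orbits g D" "a \<in> D"
  shows "cycle_type_on D g = add_mset (Perm.order g a) (cycle_type_on (D - orbit g a) g)"
proof -
  have "orbit g x \<in> insert (orbit g a) (orbit g ` (D - orbit g a))" if "x \<in> D" for x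
    using that by (cases "x \<in> orbit g a") (simp_all add: orbit_equiv)
  then have "orbit g ` D = insert (orbit g a) (orbit g ` (D - orbit g a))"
    using assms(3) by blast
  moreover have "orbit g a \<notin> orbit g ` (D - orbit g a)"
    by (metis DiffD2 imageE in_orbit_self)
  ultimately show ?thesis
    using assms(1) unfolding cycle_type_on_def by simp
qed

lemma cycle_type_on_cong:
  assumes "\<And>x. x \<in> D \<Longrightarrow> orbit g x = orbit h x"
  shows "cycle_type_on D g = cycle_type_on D h"
  unfolding cycle_type_on_def using assms by (metis (mono_tags, lifting) image_cong)

lemma cycle_type_on_insert_fixed:
  assumes "finite D" "affected g \<subseteq> D" "a \<notin> D"
  shows "cycle_type_on (insert a D) g = add_mset 1 (cycle_type_on D g)"
proof -
  have *: "orbit g a = {a}"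
    using assms by (metis not_in_affected_iff_orbit_eq_singleton subsetD)
  then have "Perm.order g a = 1" by (simp add: Perm.order_def del: card_orbit_eq)
  then show ?thesis
    using cycle_type_on_remove_orbit[of "insert a D" g a] union_of_orbits_affected[of g "insert a D"] assms *
    by auto
qed

lemma cycle_type_on_empty [simp]: "cycle_type_on {} g = {#}"
  by (simp add: cycle_type_on_def)

lemma orbits_induct [consumes 2, case_names empty remove]:
  assumes "finite D" "union_of_orbits g D"
    and "P {}"
    and "\<And>D a. finite D \<Longrightarrow> union_of_orbits g D \<Longrightarrow> a \<in> D \<Longrightarrow> P (D - orbit g a) \<Longrightarrow> P D"
  shows "P D"
  using assms(1,2)
proof (induction D rule: finite_psubset_induct)
  case (psubset D)
  show ?case
  proof (cases "D = {}")
    case False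
    then obtain a where a: "a \<in> D" by auto
    then have "D - orbit g a \<subset> D" by (metis DiffD2 Diff_subset in_orbit_self psubsetI)
    then show ?thesis
      using assms(4)[OF psubset(1) psubset.prems a] psubset.IH union_of_orbits_Diff[OF psubset.prems] by simp
  qed (use assms(3) in simp)
qed

text \<open>
  An orbit of length \<open>s\<close> contributes \<open>s\<close> equal terms. This is where the factors \<open>r\<close> and \<open>s\<close> of the
  recurrences come from.
\<close>

lemma sum_over_orbits:
  fixes F :: "nat \<Rightarrow> 'b::comm_semiring_1"
  assumes "finite D" "union_of_orbits g D"
  shows "(\<Sum>x\<in>D. F (Perm.order g x)) = (\<Sum>s\<in>#cycle_type_on D g. of_nat s * F s)"
  using assms
proof (induction rule: orbits_induct)
  case empty
  then show ?case by simp
next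
  case (remove D a)
  have sub: "orbit g a \<subseteq> D" using remove by (auto simp: union_of_orbits_def)
  have "(\<Sum>x\<in>D. F (Perm.order g x)) = (\<Sum>x\<in>D - orbit g a. F (Perm.order g x)) + (\<Sum>x\<in>orbit g a. F (Perm.order g x))"
    by (rule sum.subset_diff[OF sub remove(1)])
  also have "(\<Sum>x\<in>orbit g a. F (Perm.order g x)) = (\<Sum>x\<in>orbit g a. F (Perm.order g a))"
    by (intro sum.cong refl) (metis card_orbit_eq orbit_equiv)
  also have "\<dots> = of_nat (Perm.order g a) * F (Perm.order g a)" by simp
  finally show ?case
    using remove cycle_type_on_remove_orbit[OF remove(1-3)] by (simp add: add.commute)
qed

lemma sum_mset_cycle_type_on:
  assumes "finite D" "union_of_orbits g D"
  shows "\<Sum>\<^sub># (cycle_type_on D g) = card D"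
  using sum_over_orbits[OF assms, of "\<lambda>_. 1 :: nat"] by simp

lemma cycle_type_on_partition: "finite D \<Longrightarrow> cycle_type_on D g \<in> partitions"
  by (auto simp: cycle_type_on_def partitions_def card_eq_0_iff simp del: card_orbit_eq)

lemma order_in_cycle_type_on: "finite D \<Longrightarrow> a \<in> D \<Longrightarrow> Perm.order g a \<in># cycle_type_on D g"
  by (auto simp: cycle_type_on_def Perm.order_def simp del: card_orbit_eq)

lemma in_cycle_type_onE:
  assumes "finite D" "p \<in># cycle_type_on D g"
  obtains a where "a \<in> D" "p = Perm.order g a"
  using assms by (auto simp: cycle_type_on_def)

text \<open>
  Starting from \<open>a\<close>, the product jumps to \<open>g b\<close> and then follows \<open>g\<close> until it meets \<open>a\<close> or \<open>b\<close>. If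
  \<open>a\<close> and \<open>b\<close> lie on different cycles of \<open>g\<close>, this runs through the whole cycle of \<open>b\<close>. If they lie
  on the same cycle, it returns to \<open>a\<close> after the arc from \<open>b\<close> to \<open>a\<close>.
\<close>

lemma power_times_swap:
  assumes "\<And>i. 1 \<le> i \<Longrightarrow> i \<le> m \<Longrightarrow> (g ^ i) \<langle>$\<rangle> b \<noteq> a \<and> (g ^ i) \<langle>$\<rangle> b \<noteq> b"
  shows "((g * \<langle>a \<leftrightarrow> b\<rangle>) ^ Suc m) \<langle>$\<rangle> a = (g ^ Suc m) \<langle>$\<rangle> b"
  using assms
proof (induction m)
  case 0
  then show ?case by (simp add: apply_times)
next
  case (Suc m)
  have "((g * \<langle>a \<leftrightarrow> b\<rangle>) ^ Suc (Suc m)) \<langle>$\<rangle> a = (g * \<langle>a \<leftrightarrow> b\<rangle>) \<langle>$\<rangle> ((g ^ Suc m) \<langle>$\<rangle> b)"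
    using Suc by (simp add: apply_times)
  also have "\<dots> = g \<langle>$\<rangle> ((g ^ Suc m) \<langle>$\<rangle> b)"
    using Suc.prems[of "Suc m"] by (simp add: apply_times)
  finally show ?case by (simp add: apply_times)
qed

lemma orbit_times_swap_supset:
  assumes "a \<notin> orbit g b"
  shows "orbit g b \<subseteq> orbit (g * \<langle>a \<leftrightarrow> b\<rangle>) a"
proof
  fix x assume "x \<in> orbit g b"
  then obtain m where m: "x = (g ^ m) \<langle>$\<rangle> b" "m < Perm.order g b" by (rule in_orbitE)
  (* In power_times_swap the exponents start at 1, so b itself must be written as the power of exponent order g b. *)
  define m' where "m' = (if m = 0 then Perm.order g b else m) - 1"
  have x: "x = (g ^ Suc m') \<langle>$\<rangle> b" using m by (auto simp: m'_def simp del: power_Suc)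
  have m': "m' < Perm.order g b" using m by (auto simp: m'_def)
  have "((g * \<langle>a \<leftrightarrow> b\<rangle>) ^ Suc m') \<langle>$\<rangle> a = (g ^ Suc m') \<langle>$\<rangle> b"
  proof (rule power_times_swap)
    fix i assume "1 \<le> i" "i \<le> m'"
    then show "(g ^ i) \<langle>$\<rangle> b \<noteq> a \<and> (g ^ i) \<langle>$\<rangle> b \<noteq> b"
      using assms m' by (metis One_nat_def apply_power_eq_self_iff apply_power_self_in_orbit
          dvd_imp_le le_trans not_less Suc_le_eq)
  qed
  then show "x \<in> orbit (g * \<langle>a \<leftrightarrow> b\<rangle>) a"
    using x by (metis apply_power_self_in_orbit)
qed

lemma orbit_subsetI:
  assumes "x \<in> S" "\<And>y. y \<in> S \<Longrightarrow> g \<langle>$\<rangle> y \<in> S"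
  shows "orbit g x \<subseteq> S"
proof -
  have "(g ^ n) \<langle>$\<rangle> x \<in> S" for n
    by (induction n) (auto simp: apply_times assms)
  then show ?thesis by (auto simp: orbit_def)
qed

lemma orbit_times_swap:
  assumes "a \<notin> orbit g b"
  shows "orbit (g * \<langle>a \<leftrightarrow> b\<rangle>) a = orbit g a \<union> orbit g b"
    and "orbit (g * \<langle>a \<leftrightarrow> b\<rangle>) b = orbit g a \<union> orbit g b"
    and "x \<notin> orbit g a \<Longrightarrow> x \<notin> orbit g b \<Longrightarrow> orbit (g * \<langle>a \<leftrightarrow> b\<rangle>) x = orbit g x"
proof -
  let ?h = "g * \<langle>a \<leftrightarrow> b\<rangle>"
  have b: "b \<notin> orbit g a" using assms orbit_sym by metis
  have 1: "orbit g b \<subseteq> orbit ?h a" by (rule orbit_times_swap_supset[OF assms])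
  have 2: "orbit g a \<subseteq> orbit ?h b"
    using orbit_times_swap_supset[OF b] by (simp add: swap_sym)
  have eq: "orbit ?h b = orbit ?h a" using 1 by (metis in_orbit_self orbit_equiv subsetD)
  have "g \<langle>$\<rangle> y \<in> orbit g x" if "y \<in> orbit g x" for x y
    using that by (metis apply_self_in_orbit orbit_equiv)
  then have "?h \<langle>$\<rangle> y \<in> orbit g a \<union> orbit g b" if "y \<in> orbit g a \<union> orbit g b" for y
    using that by (cases "y = a"; cases "y = b") (auto simp: apply_times)
  then have "orbit ?h a \<subseteq> orbit g a \<union> orbit g b"
    by (intro orbit_subsetI) auto
  with 1 2 eq show "orbit ?h a = orbit g a \<union> orbit g b" "orbit ?h b = orbit g a \<union> orbit g b"
    by auto
  assume x: "x \<notin> orbit g a" "x \<notin> orbit g b"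
  have "(?h ^ n) \<langle>$\<rangle> x = (g ^ n) \<langle>$\<rangle> x" for n
  proof (induction n)
    case (Suc n)
    have "(g ^ n) \<langle>$\<rangle> x \<noteq> a" "(g ^ n) \<langle>$\<rangle> x \<noteq> b"
      using x by (metis apply_power_self_in_orbit orbit_sym)+
    then show ?case using Suc by (simp add: apply_times)
  qed simp
  then show "orbit ?h x = orbit g x" by (simp add: orbit_def)
qed

lemma order_times_swap_merge:
  assumes "a \<notin> orbit g b"
  shows "Perm.order (g * \<langle>a \<leftrightarrow> b\<rangle>) b = Perm.order g a + Perm.order g b"
proof -
  have "orbit g a \<inter> orbit g b = {}"
    using assms by (intro orbit_disjoint) (auto simp: orbit_eq_iff)
  then have "card (orbit g a \<union> orbit g b) = card (orbit g a) + card (orbit g b)"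
    by (intro card_Un_disjoint) auto
  then show ?thesis by (simp add: orbit_times_swap(2)[OF assms] Perm.order_def del: card_orbit_eq)
qed

lemma affected_times_swap:
  assumes "affected g \<subseteq> D" "a \<in> D" "b \<in> D"
  shows "affected (g * \<langle>a \<leftrightarrow> b\<rangle>) \<subseteq> D"
  using assms affected_times[of g "\<langle>a \<leftrightarrow> b\<rangle>"] affected_swap[of a b] by (cases "a = b") auto

lemma cycle_type_on_merge:
  assumes "finite D" "affected g \<subseteq> D" "a \<in> D" "b \<in> D" "a \<notin> orbit g b"
  obtains R where "cycle_type_on D g = R + {#Perm.order g a, Perm.order g b#}"
    and "cycle_type_on D (g * \<langle>a \<leftrightarrow> b\<rangle>) = R + {#Perm.order g a + Perm.order g b#}"
proof
  let ?h = "g * \<langle>a \<leftrightarrow> b\<rangle>" and ?E = "D - orbit g a - orbit g b"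
  have u: "union_of_orbits g D" "union_of_orbits ?h D"
    using union_of_orbits_affected[OF assms(2)]
      union_of_orbits_affected[OF affected_times_swap[OF assms(2-4)]] .
  have b: "b \<in> D - orbit g a" using assms(4,5) orbit_sym[of a g b] by simp
  show "cycle_type_on D g = cycle_type_on ?E g + {#Perm.order g a, Perm.order g b#}"
    using cycle_type_on_remove_orbit[OF assms(1) u(1) assms(3)]
      cycle_type_on_remove_orbit[OF _ union_of_orbits_Diff[OF u(1)] b] assms(1) by simp
  have "cycle_type_on ?E ?h = cycle_type_on ?E g"
    using orbit_times_swap(3)[OF assms(5)] by (intro cycle_type_on_cong) auto
  then show "cycle_type_on D ?h = cycle_type_on ?E g + {#Perm.order g a + Perm.order g b#}"
    using cycle_type_on_remove_orbit[OF assms(1) u(2) assms(4)]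
    by (simp add: order_times_swap_merge[OF assms(5)] orbit_times_swap(2)[OF assms(5)] Diff_eq Int_assoc)
qed

text \<open>
  The cycle of \<open>b\<close> is cut at \<open>b\<close> and at \<open>a = g\<^sup>i b\<close>. The piece with \<open>a\<close> is the arc \<open>g b, \<dots>, g\<^sup>i b\<close>, of
  length \<open>i\<close>.
\<close>

lemma order_times_swap_split:
  assumes "0 < i" "i < Perm.order g b"
  defines "a \<equiv> (g ^ i) \<langle>$\<rangle> b"
  shows "Perm.order (g * \<langle>a \<leftrightarrow> b\<rangle>) a = i" and "a \<notin> orbit (g * \<langle>a \<leftrightarrow> b\<rangle>) b"
proof -
  let ?h = "g * \<langle>a \<leftrightarrow> b\<rangle>"
  have neq: "(g ^ m) \<langle>$\<rangle> b \<noteq> a \<and> (g ^ m) \<langle>$\<rangle> b \<noteq> b" if "0 < m" "m < i" for m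
  proof -
    have "(g ^ m) \<langle>$\<rangle> b = a \<longleftrightarrow> m mod Perm.order g b = i mod Perm.order g b"
      unfolding a_def by (rule apply_power_eq_iff)
    moreover have "(g ^ m) \<langle>$\<rangle> b = b \<longleftrightarrow> Perm.order g b dvd m" by (rule apply_power_eq_self_iff)
    ultimately show ?thesis using that assms(1,2) by (auto dest: dvd_imp_le)
  qed
  have ab: "a \<noteq> b"
    using assms(1,2) unfolding a_def by (auto simp: apply_power_eq_self_iff dest: dvd_imp_le)
  have pow: "(?h ^ m) \<langle>$\<rangle> a = (g ^ m) \<langle>$\<rangle> b" if "0 < m" "m \<le> i" for m
  proof -
    have "(?h ^ Suc (m - 1)) \<langle>$\<rangle> a = (g ^ Suc (m - 1)) \<langle>$\<rangle> b"
      using neq that by (intro power_times_swap) auto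
    then show ?thesis using that by simp
  qed
  have dvd: "Perm.order ?h a dvd i" using pow[of i] assms(1) by (simp add: a_def flip: apply_power_eq_self_iff)
  have "\<not> Perm.order ?h a < i"
    using pow[of "Perm.order ?h a"] neq[of "Perm.order ?h a"] by auto
  with dvd assms(1) show ord: "Perm.order ?h a = i" by (auto dest: dvd_imp_le)
  show "a \<notin> orbit ?h b"
  proof
    assume "a \<in> orbit ?h b"
    then obtain m where m: "b = (?h ^ m) \<langle>$\<rangle> a" "m < i"
      using orbit_sym in_orbitE ord by metis
    then show False using ab neq[of m] pow[of m] by (cases "m = 0") auto
  qed
qed

text \<open>
  Multiplying by the same transposition again undoes the cut, so that the length of the piece with \<open>b\<close>
  can be read off from \<open>cycle_type_on_merge\<close>.
\<close>

lemma cycle_type_on_split: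
  assumes "finite D" "affected g \<subseteq> D" "b \<in> D" "0 < i" "i < Perm.order g b"
  obtains R where "cycle_type_on D g = R + {#Perm.order g b#}"
    and "cycle_type_on D (g * \<langle>(g ^ i) \<langle>$\<rangle> b \<leftrightarrow> b\<rangle>) = R + {#i, Perm.order g b - i#}"
proof -
  define a where "a = (g ^ i) \<langle>$\<rangle> b"
  let ?h = "g * \<langle>a \<leftrightarrow> b\<rangle>"
  have a: "a \<in> D" using assms(2,3) union_of_orbits_affected[of g D]
    unfolding a_def union_of_orbits_def by (metis apply_power_self_in_orbit subsetD)
  have h: "affected ?h \<subseteq> D" using affected_times_swap[OF assms(2) a assms(3)] .
  have nin: "a \<notin> orbit ?h b" and ord: "Perm.order ?h a = i"
    using order_times_swap_split[OF assms(4,5)] by (simp_all add: a_def)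
  have undo: "?h * \<langle>a \<leftrightarrow> b\<rangle> = g" by (simp add: mult.assoc)
  obtain R where R: "cycle_type_on D ?h = R + {#Perm.order ?h a, Perm.order ?h b#}"
    "cycle_type_on D g = R + {#Perm.order ?h a + Perm.order ?h b#}"
    using cycle_type_on_merge[OF assms(1) h a assms(3) nin] undo by metis
  have "Perm.order g b = Perm.order ?h a + Perm.order ?h b"
    using order_times_swap_merge[OF nin] undo by metis
  then show ?thesis using that[of R] R ord by (simp add: a_def)
qed

lemma ex_perm_extending_bij_betw:
  assumes "finite D" "finite E" "bij_betw f D E"
  obtains \<pi> where "affected \<pi> \<subseteq> D \<union> E" "\<And>x. x \<in> D \<Longrightarrow> \<pi> \<langle>$\<rangle> x = f x"
proof -
  have "card (E - D) = card (D - E)"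
    using assms bij_betw_same_card[OF assms(3)] by (simp add: card_Diff_subset_Int Int_commute)
  then obtain f' where f': "bij_betw f' (E - D) (D - E)"
    using assms by (metis finite_Diff finite_same_card_bij)
  define F where "F x = (if x \<in> D then f x else if x \<in> E then f' x else x)" for x
  have 1: "bij_betw F D E" using assms(3) by (simp add: F_def cong: bij_betw_cong)
  have 2: "bij_betw F (E - D) (D - E)" using f' by (rule bij_betw_cong[THEN iffD1, rotated]) (auto simp: F_def)
  have 3: "bij_betw F (- (D \<union> E)) (- (D \<union> E))"
    by (rule bij_betw_cong[THEN iffD1, OF _ bij_betw_id]) (auto simp: F_def)
  have "bij_betw F (D \<union> (E - D) \<union> - (D \<union> E)) (E \<union> (D - E) \<union> - (D \<union> E))"
    using 1 2 3 by (intro bij_betw_combine) auto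
  moreover have "D \<union> (E - D) \<union> - (D \<union> E) = UNIV" "E \<union> (D - E) \<union> - (D \<union> E) = UNIV" by auto
  ultimately have "bij F" by simp
  moreover have "{x. F x \<noteq> x} \<subseteq> D \<union> E" by (auto simp: F_def)
  ultimately have ap: "apply (Perm F) = F"
    using assms(1,2) by (intro Perm_inverse) (auto intro: finite_subset)
  show ?thesis
    by (rule that[of "Perm F"]) (use \<open>{x. F x \<noteq> x} \<subseteq> D \<union> E\<close> in \<open>auto simp: in_affected ap F_def\<close>)
qed

text \<open>
  The bijection is \<open>g\<^sup>m a \<mapsto> g'\<^sup>m a'\<close>. It is well defined because both sides depend on \<open>m\<close> modulo the common
  order only.
\<close>

lemma ex_orbit_bijection:
  assumes "Perm.order g a = Perm.order g' a'"
  obtains f where "bij_betw f (orbit g a) (orbit g' a')"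
    "\<And>x. x \<in> orbit g a \<Longrightarrow> f (g \<langle>$\<rangle> x) = g' \<langle>$\<rangle> (f x)"
proof -
  let ?n = "Perm.order g a"
  let ?\<phi> = "\<lambda>m. (g ^ m) \<langle>$\<rangle> a" and ?\<psi> = "\<lambda>m. (g' ^ m) \<langle>$\<rangle> a'"
  have b1: "bij_betw ?\<phi> {..<?n} (orbit g a)"
    by (simp add: bij_betw_def inj_on_apply_range orbit_unfold_image)
  have b2: "bij_betw ?\<psi> {..<?n} (orbit g' a')"
    by (simp add: assms bij_betw_def inj_on_apply_range orbit_unfold_image)
  define f where "f = ?\<psi> \<circ> inv_into {..<?n} ?\<phi>"
  have f: "f (?\<phi> m) = ?\<psi> m" for m
  proof -
    have "f (?\<phi> (m mod ?n)) = ?\<psi> (m mod ?n)"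
      using bij_betw_inv_into_left[OF b1, of "m mod ?n"] by (simp add: f_def del: apply_power_mod_order_eq)
    then show ?thesis by (metis apply_power_mod_order_eq assms)
  qed
  show ?thesis
  proof
    show "bij_betw f (orbit g a) (orbit g' a')"
      unfolding f_def using b1 b2 bij_betw_inv_into bij_betw_trans by blast
    fix x assume "x \<in> orbit g a"
    then obtain m where m: "x = ?\<phi> m" by (rule in_orbitE)
    then have "f (g \<langle>$\<rangle> x) = f (?\<phi> (Suc m))" by (simp add: apply_times)
    then show "f (g \<langle>$\<rangle> x) = g' \<langle>$\<rangle> (f x)" by (simp only: f m) (simp add: apply_times)
  qed
qed

lemma ex_equivariant_bijection:
  assumes "finite D" "union_of_orbits g D" "finite D'" "union_of_orbits g' D'"
    "cycle_type_on D g = cycle_type_on D' g'"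
  shows "\<exists>f. bij_betw f D D' \<and> (\<forall>x\<in>D. f (g \<langle>$\<rangle> x) = g' \<langle>$\<rangle> (f x))"
  using assms
proof (induction arbitrary: D' rule: orbits_induct)
  case empty
  then have "D' = {}" by (auto simp: cycle_type_on_def mset_set_empty_iff)
  then show ?case by (auto simp: bij_betw_def)
next
  case (remove D a)
  have "Perm.order g a \<in># cycle_type_on D' g'"
    using order_in_cycle_type_on[OF remove(1,3)] remove.prems by metis
  then obtain a' where a': "a' \<in> D'" "Perm.order g a = Perm.order g' a'"
    using remove.prems in_cycle_type_onE by metis
  have "cycle_type_on (D - orbit g a) g = cycle_type_on (D' - orbit g' a') g'"
    using cycle_type_on_remove_orbit[OF remove(1-3)]
      cycle_type_on_remove_orbit[OF remove.prems(1,2) a'(1)] remove.prems(3) a'(2) by simp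
  then obtain f1 where f1: "bij_betw f1 (D - orbit g a) (D' - orbit g' a')"
      "\<forall>x\<in>D - orbit g a. f1 (g \<langle>$\<rangle> x) = g' \<langle>$\<rangle> (f1 x)"
    using remove.IH[of "D' - orbit g' a'"] remove.prems union_of_orbits_Diff by (metis finite_Diff)
  obtain f2 where f2: "bij_betw f2 (orbit g a) (orbit g' a')"
    "\<And>x. x \<in> orbit g a \<Longrightarrow> f2 (g \<langle>$\<rangle> x) = g' \<langle>$\<rangle> (f2 x)"
    using ex_orbit_bijection[OF a'(2)] by blast
  define f where "f x = (if x \<in> orbit g a then f2 x else f1 x)" for x
  have "bij_betw f (orbit g a) (orbit g' a')" using f2(1) by (simp add: f_def cong: bij_betw_cong)
  moreover have "bij_betw f (D - orbit g a) (D' - orbit g' a')"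
    using f1(1) by (rule bij_betw_cong[THEN iffD1, rotated]) (auto simp: f_def)
  ultimately have "bij_betw f (orbit g a \<union> (D - orbit g a)) (orbit g' a' \<union> (D' - orbit g' a'))"
    by (rule bij_betw_combine) auto
  moreover have "orbit g a \<union> (D - orbit g a) = D" "orbit g' a' \<union> (D' - orbit g' a') = D'"
    using remove a' by (auto simp: union_of_orbits_def)
  ultimately have "bij_betw f D D'" by simp
  moreover have "f (g \<langle>$\<rangle> x) = g' \<langle>$\<rangle> (f x)" if "x \<in> D" for x
  proof -
    have "g \<langle>$\<rangle> x \<in> orbit g a \<longleftrightarrow> x \<in> orbit g a"
      by (metis orbit_apply orbit_eq_iff)
    then show ?thesis using f1(2) f2(2) that by (auto simp: f_def)
  qed
  ultimately show ?case by blast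
qed

text \<open>
  Orbits of equal length are matched one by one, which gives an equivariant bijection from \<open>D\<close> to \<open>D'\<close>.
  Any extension of it to a permutation conjugates \<open>g\<close> to \<open>g'\<close>, since both are trivial outside these sets.
\<close>

lemma cycle_type_on_eq_imp_conjugate:
  assumes "finite D" "affected g \<subseteq> D" "finite D'" "affected g' \<subseteq> D'"
    "cycle_type_on D g = cycle_type_on D' g'"
  obtains \<pi> where "affected \<pi> \<subseteq> D \<union> D'" "apply \<pi> ` D = D'" "\<pi> * g * inverse \<pi> = g'"
proof -
  obtain f where f: "bij_betw f D D'" "\<forall>x\<in>D. f (g \<langle>$\<rangle> x) = g' \<langle>$\<rangle> (f x)"
    using ex_equivariant_bijection[OF assms(1) union_of_orbits_affected[OF assms(2)] assms(3)
        union_of_orbits_affected[OF assms(4)] assms(5)] by blast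
  obtain \<pi> where \<pi>: "affected \<pi> \<subseteq> D \<union> D'" "\<And>x. x \<in> D \<Longrightarrow> \<pi> \<langle>$\<rangle> x = f x"
    using ex_perm_extending_bij_betw[OF assms(1,3) f(1)] by blast
  have im: "apply \<pi> ` D = D'" using f(1) \<pi>(2) by (simp add: bij_betw_def)
  have gD: "g \<langle>$\<rangle> x \<in> D" if "x \<in> D" for x
    using that union_of_orbits_affected[OF assms(2)] by (metis apply_self_in_orbit subsetD union_of_orbits_def)
  have "\<pi> * g = g' * \<pi>"
  proof (rule perm_eqI)
    fix x
    show "(\<pi> * g) \<langle>$\<rangle> x = (g' * \<pi>) \<langle>$\<rangle> x"
    proof (cases "x \<in> D")
      case True
      then show ?thesis using f(2) \<pi>(2) gD by (simp add: apply_times)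
    next
      case False
      then have "\<pi> \<langle>$\<rangle> x \<notin> D'" using im apply_inj by (metis imageE)
      then have "g' \<langle>$\<rangle> (\<pi> \<langle>$\<rangle> x) = \<pi> \<langle>$\<rangle> x" "g \<langle>$\<rangle> x = x"
        using False assms(2,4) by (auto simp: in_affected subset_iff)
      then show ?thesis by (simp add: apply_times)
    qed
  qed
  then have "\<pi> * g * inverse \<pi> = g'" by (simp add: mult.assoc)
  then show ?thesis using that \<pi>(1) im by blast
qed

text \<open>
  A cycle of length \<open>r + 1\<close> is obtained by merging one of length \<open>r\<close> with a new fixed point.
\<close>

lemma ex_perm_of_cycle_type:
  assumes "\<rho> \<in> partitions"
  shows "\<exists>n g. affected g \<subseteq> {1..n::nat} \<and> cycle_type_on {1..n} g = \<rho>"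
proof -
  define realised where "realised \<rho> \<longleftrightarrow> (\<exists>n g. affected g \<subseteq> {1..n::nat} \<and> cycle_type_on {1..n} g = \<rho>)" for \<rho>
  have one: "realised (add_mset 1 \<rho>)" if r: "realised \<rho>" for \<rho>
  proof -
    obtain n g where g: "affected g \<subseteq> {1..n::nat}" "cycle_type_on {1..n} g = \<rho>"
      using r unfolding realised_def by blast
    then have "cycle_type_on (insert (Suc n) {1..n}) g = add_mset 1 \<rho>"
      using cycle_type_on_insert_fixed[of "{1..n}" g "Suc n"] by simp
    moreover have "insert (Suc n) {1..n} = {1..Suc n}" by auto
    ultimately show ?thesis using g unfolding realised_def by (metis subset_insertI subset_trans)
  qed
  have part: "realised (add_mset (Suc r) \<rho>)" if "realised \<rho>" for r \<rho>
    using that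
  proof (induction r)
    case 0
    then show ?case using one by simp
  next
    case (Suc r)
    have "realised (add_mset 1 (add_mset (Suc r) \<rho>))" using Suc one by blast
    then obtain n g where g: "affected g \<subseteq> {1..n::nat}" "cycle_type_on {1..n} g = \<rho> + {#1, Suc r#}"
      unfolding realised_def by auto
    obtain a where a: "a \<in> {1..n}" "1 = Perm.order g a"
      using in_cycle_type_onE[of "{1..n}" 1 g] g by auto
    have "cycle_type_on ({1..n} - orbit g a) g = \<rho> + {#Suc r#}"
      using cycle_type_on_remove_orbit[of "{1..n}" g a] union_of_orbits_affected[OF g(1)] a g(2) by simp
    then obtain b where b: "b \<in> {1..n} - orbit g a" "Suc r = Perm.order g b"
      using in_cycle_type_onE[of "{1..n} - orbit g a" "Suc r" g] by auto
    then have "a \<notin> orbit g b" using orbit_sym[of a g b] by simp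
    then obtain R where "cycle_type_on {1..n} g = R + {#Perm.order g a, Perm.order g b#}"
      "cycle_type_on {1..n} (g * \<langle>a \<leftrightarrow> b\<rangle>) = R + {#Perm.order g a + Perm.order g b#}"
      using cycle_type_on_merge[of "{1..n}" g a b] g(1) a b by auto
    then have "cycle_type_on {1..n} (g * \<langle>a \<leftrightarrow> b\<rangle>) = add_mset (Suc (Suc r)) \<rho>"
      using g(2) a(2)[symmetric] b(2)[symmetric] by simp
    moreover have "affected (g * \<langle>a \<leftrightarrow> b\<rangle>) \<subseteq> {1..n}"
      using affected_times_swap[OF g(1)] a b by auto
    ultimately show ?case unfolding realised_def by blast
  qed
  have "realised \<rho>" using assms
  proof (induction \<rho>)
    case empty
    have "affected (1::nat perm) \<subseteq> {1..0}" "cycle_type_on {1..0::nat} 1 = {#}" by auto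
    then show ?case unfolding realised_def by blast
  next
    case (add p \<rho>)
    then show ?case using part[of \<rho> "p - 1"] by (auto simp: partitions_def)
  qed
  then show ?thesis unfolding realised_def .
qed

section \<open>One-row Hall-Littlewood polynomials in a ring\<close>

lemma finite_partitions_le: "finite {\<mu> \<in> partitions. \<Sum>\<^sub># \<mu> \<le> k}"
proof (rule finite_subset)
  show "{\<mu> \<in> partitions. \<Sum>\<^sub># \<mu> \<le> k} \<subseteq> mset ` {xs. set xs \<subseteq> {..k} \<and> length xs \<le> k}"
  proof
    fix \<mu> assume "\<mu> \<in> {\<mu> \<in> partitions. \<Sum>\<^sub># \<mu> \<le> k}"
    then have \<mu>: "0 \<notin># \<mu>" "\<Sum>\<^sub># \<mu> \<le> k" by (auto simp: partitions_def)
    from \<mu>(1) have size: "size \<mu> \<le> \<Sum>\<^sub># \<mu>" by (induction \<mu>) auto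
    obtain xs where xs: "\<mu> = mset xs" using ex_mset by metis
    have "x \<le> k" if "x \<in># \<mu>" for x
      using that \<mu>(2) by (auto dest!: multi_member_split)
    then have "xs \<in> {xs. set xs \<subseteq> {..k} \<and> length xs \<le> k}"
      using xs \<mu>(2) size by auto
    then show "\<mu> \<in> mset ` {xs. set xs \<subseteq> {..k} \<and> length xs \<le> k}" using xs by auto
  qed
  show "finite (mset ` {xs. set xs \<subseteq> {..k} \<and> length xs \<le> k})"
    by (intro finite_imageI finite_lists_length_le) simp
qed

definition exponents :: "nat \<Rightarrow> nat \<Rightarrow> nat list set"
  where "exponents n k = {\<alpha>. length \<alpha> = n \<and> sum_list \<alpha> = k}"

lemma finite_exponents: "finite (exponents n k)"
proof (rule finite_subset)
  show "exponents n k \<subseteq> {xs. set xs \<subseteq> {..k} \<and> length xs = n}"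
    by (auto simp: exponents_def member_le_sum_list)
qed (simp add: finite_lists_length_eq)

definition term_weight :: "'a::ring_1 \<Rightarrow> nat list \<Rightarrow> 'a"
  where "term_weight t \<alpha> = (1 - t) ^ (length (filter (\<lambda>a. a \<noteq> 0) \<alpha>) - 1)"

text \<open>
  The sums over partitions and over the exponent vectors of a given type are merged into a single sum
  over exponent vectors, in which the last variable can be split off.
\<close>

lemma hall_littlewood_row_exponents:
  "hall_littlewood_row k xs t =
    (\<Sum>\<alpha>\<in>exponents (length xs) k. term_weight t \<alpha> * prod_list (map2 (^) xs \<alpha>))"
proof -
  let ?M = "{\<mu> \<in> partitions. \<Sum>\<^sub># \<mu> = k}"
  let ?type = "\<lambda>\<alpha>. filter_mset (\<lambda>a. a \<noteq> 0) (mset \<alpha>)"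
  let ?f = "\<lambda>\<alpha>. term_weight t \<alpha> * prod_list (map2 (^) xs \<alpha>)"
  have sum: "\<Sum>\<^sub># (?type \<alpha>) = sum_list \<alpha>" for \<alpha> :: "nat list"
    by (induction \<alpha>) auto
  have pos: "(\<lambda>a::nat. a \<noteq> 0) = (<) 0" by auto
  have "finite ?M" by (rule finite_subset[OF _ finite_partitions_le[of k]]) auto
  moreover have "?type ` exponents (length xs) k \<subseteq> ?M"
    by (auto simp: exponents_def partitions_def sum[unfolded pos] simp del: mset_filter)
  ultimately have "(\<Sum>\<alpha>\<in>exponents (length xs) k. ?f \<alpha>) =
      (\<Sum>\<mu>\<in>?M. \<Sum>\<alpha> | \<alpha> \<in> exponents (length xs) k \<and> ?type \<alpha> = \<mu>. ?f \<alpha>)"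
    by (intro sum.group[symmetric] finite_exponents) auto
  also have "\<dots> = hall_littlewood_row k xs t"
    unfolding hall_littlewood_row_def
  proof (rule sum.cong[OF refl])
    fix \<mu> assume "\<mu> \<in> ?M"
    then have set: "{\<alpha>. \<alpha> \<in> exponents (length xs) k \<and> ?type \<alpha> = \<mu>} = {\<alpha>. length \<alpha> = length xs \<and> ?type \<alpha> = \<mu>}"
      using sum by (auto simp: exponents_def simp del: mset_filter)
    show "(\<Sum>\<alpha> | \<alpha> \<in> exponents (length xs) k \<and> ?type \<alpha> = \<mu>. ?f \<alpha>) = (1 - t) ^ (size \<mu> - 1) * monomial_sym \<mu> xs"
      unfolding set monomial_sym_def sum_distrib_left
      by (intro sum.cong refl) (auto simp: term_weight_def simp flip: size_mset mset_filter)
  qed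
  finally show ?thesis by simp
qed

lemma exponents_Suc:
  "exponents (Suc n) k = (\<Union>a\<in>{..k}. (\<lambda>\<alpha>. \<alpha> @ [a]) ` exponents n (k - a))" (is "?A = ?B")
proof
  show "?A \<subseteq> ?B"
  proof
    fix \<beta> assume \<beta>: "\<beta> \<in> ?A"
    then obtain \<alpha> a where "\<beta> = \<alpha> @ [a]" unfolding exponents_def by (auto simp: length_Suc_conv_rev)
    then show "\<beta> \<in> ?B" using \<beta> by (auto simp: exponents_def intro!: bexI[of _ a] image_eqI[of _ _ \<alpha>])
  qed
  show "?B \<subseteq> ?A" by (auto simp: exponents_def)
qed

lemma exponents_0_right: "exponents n 0 = {replicate n 0}"
  by (auto simp: exponents_def intro!: replicate_eqI)

lemma hall_littlewood_row_Nil: "k \<ge> 1 \<Longrightarrow> hall_littlewood_row k [] t = 0"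
  by (auto simp: hall_littlewood_row_exponents exponents_def intro!: sum.neutral)

lemma hall_littlewood_row_snoc_expand:
  assumes "k \<ge> 1"
  shows "hall_littlewood_row k (xs @ [x]) t =
    hall_littlewood_row k xs t + x ^ k + (1 - t) * (\<Sum>a\<in>{1..<k}. hall_littlewood_row (k - a) xs t * x ^ a)"
proof -
  let ?n = "length xs"
  let ?f = "\<lambda>xs \<alpha>. term_weight t \<alpha> * prod_list (map2 (^) xs \<alpha>)"
  let ?g = "\<lambda>a. \<Sum>\<alpha>\<in>exponents ?n (k - a). ?f (xs @ [x]) (\<alpha> @ [a])"
  have "hall_littlewood_row k (xs @ [x]) t = (\<Sum>\<alpha>\<in>exponents (Suc ?n) k. ?f (xs @ [x]) \<alpha>)"
    by (simp add: hall_littlewood_row_exponents)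
  also have "\<dots> = (\<Sum>a\<in>{..k}. sum (?f (xs @ [x])) ((\<lambda>\<alpha>. \<alpha> @ [a]) ` exponents ?n (k - a)))"
    unfolding exponents_Suc by (rule sum.UNION_disjoint) (auto simp: finite_exponents)
  also have "\<dots> = (\<Sum>a\<in>{..k}. ?g a)"
    by (rule sum.cong[OF refl], subst sum.reindex) (auto simp: inj_on_def)
  also have "{..k} = insert 0 (insert k {1..<k})" using assms by auto
  also have "sum ?g (insert 0 (insert k {1..<k})) = ?g 0 + (?g k + sum ?g {1..<k})"
    using assms by simp
  also have "?g 0 = hall_littlewood_row k xs t"
    by (auto simp: hall_littlewood_row_exponents term_weight_def exponents_def intro!: sum.cong)
  also have "?g k = x ^ k"
  proof -
    have "prod_list (map2 (^) xs (replicate (length xs) 0)) = 1" for xs :: "'a list"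
      by (induction xs) auto
    then show ?thesis using assms by (simp add: exponents_0_right term_weight_def)
  qed
  also have "sum ?g {1..<k} = (1 - t) * (\<Sum>a\<in>{1..<k}. hall_littlewood_row (k - a) xs t * x ^ a)"
    unfolding sum_distrib_left
  proof (rule sum.cong[OF refl])
    fix a assume a: "a \<in> {1..<k}"
    have "?f (xs @ [x]) (\<alpha> @ [a]) = (1 - t) * (?f xs \<alpha> * x ^ a)" if "\<alpha> \<in> exponents ?n (k - a)" for \<alpha>
    proof -
      have "filter (\<lambda>a. a \<noteq> 0) \<alpha> \<noteq> []"
      proof
        assume "filter (\<lambda>a. a \<noteq> 0) \<alpha> = []"
        then have "sum_list \<alpha> = 0" by (simp add: filter_empty_conv)
        moreover have "sum_list \<alpha> = k - a" using that by (simp add: exponents_def)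
        ultimately have "k - a = 0" by (simp only:)
        then show False using a by simp
      qed
      then obtain m where "length (filter (\<lambda>a. a \<noteq> 0) \<alpha>) = Suc m"
        by (cases "filter (\<lambda>a. a \<noteq> 0) \<alpha>") auto
      moreover have "length \<alpha> = ?n" using that by (simp add: exponents_def)
      ultimately show ?thesis using a by (simp add: term_weight_def mult.assoc)
    qed
    then show "?g a = (1 - t) * (hall_littlewood_row (k - a) xs t * x ^ a)"
      by (simp add: hall_littlewood_row_exponents sum_distrib_left sum_distrib_right)
  qed
  finally show ?thesis by (simp add: add.assoc)
qed

lemma hall_littlewood_row_1_snoc:
  "hall_littlewood_row 1 (xs @ [x]) t = hall_littlewood_row 1 xs t + x"
  by (simp add: hall_littlewood_row_snoc_expand)

text \<open>
  Let \<open>Q(xs) = 1 + (1 - t) \<Sum>\<^sub>k P\<^sub>k(xs) u\<^sup>k\<close>. The product formula for \<open>Q\<close> says that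
  \<open>Q(xs, x) (1 - u x) = Q(xs) (1 - t u x)\<close>, and this is the equation between the coefficients of
  \<open>u\<^sup>k\<^sup>+\<^sup>1\<close>, divided by \<open>1 - t\<close>. The constant term of \<open>Q\<close> is not divisible by \<open>1 - t\<close>, hence the
  restriction to \<open>k \<ge> 1\<close>.
\<close>

lemma hall_littlewood_row_Suc_snoc:
  assumes "k \<ge> 1"
  shows "hall_littlewood_row (Suc k) (xs @ [x]) t =
    hall_littlewood_row (Suc k) xs t + (hall_littlewood_row k (xs @ [x]) t - t * hall_littlewood_row k xs t) * x"
proof -
  let ?H = "\<lambda>k. hall_littlewood_row k xs t"
  let ?s = "\<Sum>a\<in>{1..<k}. ?H (k - a) * x ^ a"
  have "(\<Sum>a\<in>{1..<Suc k}. ?H (Suc k - a) * x ^ a) = (\<Sum>a\<in>{0..<k}. ?H (k - a) * x ^ Suc a)"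
    using sum.shift_bounds_Suc_ivl[of "\<lambda>a. ?H (Suc k - a) * x ^ a" 0 k] by simp
  also have "\<dots> = ?H k * x + (\<Sum>a\<in>{1..<k}. ?H (k - a) * x ^ Suc a)"
    using assms by (simp add: sum.atLeast_Suc_lessThan)
  also have "(\<Sum>a\<in>{1..<k}. ?H (k - a) * x ^ Suc a) = ?s * x"
    by (simp only: sum_distrib_right power_Suc2 mult.assoc)
  finally have shift: "(\<Sum>a\<in>{1..<Suc k}. ?H (Suc k - a) * x ^ a) = ?H k * x + ?s * x" .
  have e1: "hall_littlewood_row (Suc k) (xs @ [x]) t = ?H (Suc k) + x ^ Suc k + (1 - t) * (?H k * x + ?s * x)"
    using hall_littlewood_row_snoc_expand[of "Suc k" xs x t] unfolding shift by simp
  have e2: "hall_littlewood_row k (xs @ [x]) t = ?H k + x ^ k + (1 - t) * ?s"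
    using hall_littlewood_row_snoc_expand[OF assms] .
  show ?thesis
    unfolding e1 e2 by (simp add: algebra_simps power_Suc2 del: power_Suc)
qed

lemma hall_littlewood_row_invariant:
  assumes P0: "P 0" and Pt: "P t" and xs: "\<And>x. x \<in> set xs \<Longrightarrow> P x"
    and add: "\<And>a b. P a \<Longrightarrow> P b \<Longrightarrow> P (a + b)"
    and diff: "\<And>a b. P a \<Longrightarrow> P b \<Longrightarrow> P (a - b)"
    and mult: "\<And>a b. P a \<Longrightarrow> P b \<Longrightarrow> P (a * b)"
    and k: "k \<ge> 1"
  shows "P (hall_littlewood_row k xs t)"
  using xs k
proof (induction xs arbitrary: k rule: rev_induct)
  case Nil
  then show ?case by (simp add: hall_littlewood_row_Nil P0)
next
  case (snoc x xs)
  show ?case using \<open>k \<ge> 1\<close>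
  proof (induction k rule: dec_induct)
    case base
    then show ?case using snoc by (auto simp only: hall_littlewood_row_1_snoc intro!: add) auto
  next
    case (step k)
    then show ?case using snoc Pt
      by (auto simp: hall_littlewood_row_Suc_snoc intro!: add mult diff)
  qed
qed

text \<open>
  Stated for an arbitrary map \<open>F\<close> because it is applied to conjugations as well as to the map that
  forgets the sets of partial permutations and extends the scalars.
\<close>

lemma hall_littlewood_row_hom:
  assumes F0: "F 0 = 0"
    and add: "\<And>a b. F (a + b) = F a + F b"
    and diff: "\<And>a b. F (a - b) = F a - F b"
    and mult: "\<And>a b. F (a * b) = F a * F b"
    and k: "k \<ge> 1"
  shows "F (hall_littlewood_row k xs t) = hall_littlewood_row k (map F xs) (F t)"
  using k
proof (induction xs arbitrary: k rule: rev_induct)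
  case Nil
  then show ?case by (simp add: hall_littlewood_row_Nil F0)
next
  case (snoc x xs)
  show ?case using \<open>k \<ge> 1\<close>
  proof (induction k rule: dec_induct)
    case base
    show ?case using snoc.IH[of 1] by (simp only: hall_littlewood_row_1_snoc map_append list.map add order_refl)
  next
    case (step k)
    then show ?case using snoc.IH[of k] snoc.IH[of "Suc k"]
      by (simp add: hall_littlewood_row_Suc_snoc add diff mult)
  qed
qed

text \<open>
  With two more variables the product formula involves \<open>(1 - u x) (1 - u y)\<close> and
  \<open>(1 - t u x) (1 - t u y)\<close>, so that the two-step recurrence contains \<open>x\<close> and \<open>y\<close> only through \<open>x + y\<close>
  and \<open>y x\<close>. In the application \<open>F\<close> is the conjugation by an adjacent transposition \<open>s\<close>, whose effect on
  two consecutive Jucys-Murphy elements is given by the hypotheses on \<open>x\<close>, \<open>y\<close> and \<open>s\<close>.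
\<close>

lemma hall_littlewood_row_exchange:
  fixes t x y s :: "'a::ring_1" and xs :: "'a list"
  defines "C \<equiv> \<lambda>k. hall_littlewood_row k (xs @ [x, y]) t"
  assumes add: "\<And>a b. F (a + b) = F a + F b"
    and diff: "\<And>a b. F (a - b) = F a - F b"
    and mult: "\<And>a b. F (a * b) = F a * F b"
    and xs: "\<And>x. x \<in> set xs \<Longrightarrow> F x = x" and t: "F t = t"
    and x: "F x = y - s" and y: "F y = x + s"
    and s: "s * F x = x * s" and comm: "x * y = y * x"
    and k: "k \<ge> 1"
  shows "F (C k) = C k"
proof -
  define A where "A k = hall_littlewood_row k xs t" for k
  define B where "B k = hall_littlewood_row k (xs @ [x]) t" for k
  have F0: "F 0 = 0" using diff[of 0 0] by simp
  have FA: "F (A k) = A k" if "k \<ge> 1" for k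
    using hall_littlewood_row_hom[of F k xs t, OF F0 add diff mult that] xs t
    by (simp add: A_def map_idI)
  have C: "C k = hall_littlewood_row k ((xs @ [x]) @ [y]) t" for k by (simp add: C_def)
  have B1: "B 1 = A 1 + x" and C1: "C 1 = B 1 + y"
    unfolding A_def B_def C by (rule hall_littlewood_row_1_snoc)+
  have BS: "B (Suc k) = A (Suc k) + (B k - t * A k) * x"
    and CS: "C (Suc k) = B (Suc k) + (C k - t * B k) * y" if "k \<ge> 1" for k
    unfolding A_def B_def C using hall_littlewood_row_Suc_snoc[OF that] by blast+
  have C2: "C (Suc 1) = A (Suc 1) + (A 1 - t * A 1) * (x + y) + (x + y) * (x + y) - y * x - t * (y * x)"
    by (simp add: CS[of 1, simplified] BS[of 1, simplified] C1[simplified] B1[simplified] algebra_simps comm)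
  have C3: "C (Suc (Suc k)) = A (Suc (Suc k)) + C (Suc k) * (x + y) - C k * (y * x)
      - t * (A (Suc k) * (x + y)) + t * (t * (A k * (y * x)))" if "k \<ge> 1" for k
    using that by (simp add: CS[of "Suc k"] BS[of "Suc k"] CS[of k] BS[of k] algebra_simps comm)
  have Fp: "F (x + y) = x + y" by (simp add: add x y)
  have "s * y = x * s + s * s" using s x by (simp add: algebra_simps)
  then have Fq: "F (y * x) = y * x" using comm by (simp add: mult x y algebra_simps)
  define p q where "p = x + y" and "q = y * x"
  have "F (C k) = C k \<and> F (C (Suc k)) = C (Suc k)"
    using k
  proof (induction k rule: dec_induct)
    case base
    have "C 1 = A 1 + (x + y)" by (simp only: C1 B1 add.assoc)
    then have "F (C 1) = C 1" by (simp only: add[of "A 1"] FA[OF order_refl] Fp)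
    moreover have "F (C (Suc 1)) = C (Suc 1)"
      unfolding C2 using FA[of 1] FA[of "Suc 1"] by (simp only: add diff mult Fp Fq t)
        (simp add: Fp[simplified add] Fq[simplified mult])
    ultimately show ?case by simp
  next
    case (step k)
    have "F (C (Suc (Suc k))) = C (Suc (Suc k))"
      unfolding C3[OF step(1), folded p_def q_def]
      using step.IH FA[of k] FA[of "Suc k"] FA[of "Suc (Suc k)"] step(1)
      by (simp add: add diff mult t Fp[folded p_def] Fq[folded q_def])
    then show ?case using step by simp
  qed
  then show ?thesis ..
qed

section \<open>Push-forwards of finitely supported functions\<close>

text \<open>
  For a homomorphism \<open>f\<close> of monoids and a homomorphism \<open>\<phi>\<close> of the rings of scalars, this is the induced
  homomorphism of monoid algebras.
\<close>

definition push_forward :: "('a \<Rightarrow> 'c) \<Rightarrow> ('b \<Rightarrow> 'd) \<Rightarrow> ('a \<Rightarrow>\<^sub>0 'b::zero) \<Rightarrow> ('c \<Rightarrow>\<^sub>0 'd::comm_monoid_add)"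
  where "push_forward f \<phi> p = (\<Sum>a\<in>Poly_Mapping.keys p. Poly_Mapping.single (f a) (\<phi> (Poly_Mapping.lookup p a)))"

context
  fixes \<phi> :: "'b::comm_ring_1 \<Rightarrow> 'd::comm_ring_1"
  assumes additive: "\<And>a b. \<phi> (a + b) = \<phi> a + \<phi> b"
begin

lemma additive_0: "\<phi> 0 = 0"
  using additive[of 0 0] by simp

lemma push_forward_superset:
  assumes "finite S" "Poly_Mapping.keys p \<subseteq> S"
  shows "push_forward f \<phi> p = (\<Sum>a\<in>S. Poly_Mapping.single (f a) (\<phi> (Poly_Mapping.lookup p a)))"
  unfolding push_forward_def using assms
  by (intro sum.mono_neutral_left) (auto simp: in_keys_iff additive_0)

lemma push_forward_add: "push_forward f \<phi> (p + q) = push_forward f \<phi> p + push_forward f \<phi> q"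
proof -
  let ?S = "Poly_Mapping.keys p \<union> Poly_Mapping.keys q"
  show ?thesis
    using push_forward_superset[of ?S "p + q" f] push_forward_superset[of ?S p f] push_forward_superset[of ?S q f]
      Poly_Mapping.keys_add[of p q]
    by (simp add: lookup_add additive single_add sum.distrib)
qed

lemma push_forward_0: "push_forward f \<phi> 0 = 0"
  by (simp add: push_forward_def)

lemma push_forward_diff: "push_forward f \<phi> (p - q) = push_forward f \<phi> p - push_forward f \<phi> q"
  using push_forward_add[of f "p - q" q] by simp

lemma push_forward_sum: "push_forward f \<phi> (\<Sum>i\<in>I. p i) = (\<Sum>i\<in>I. push_forward f \<phi> (p i))"
  by (induction I rule: infinite_finite_induct) (simp_all add: push_forward_0 push_forward_add)

lemma push_forward_single: "push_forward f \<phi> (Poly_Mapping.single a b) = Poly_Mapping.single (f a) (\<phi> b)"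
  by (cases "b = 0") (simp_all add: push_forward_def additive_0)

lemma lookup_push_forward:
  assumes "finite S" "\<And>a. f a = c \<Longrightarrow> Poly_Mapping.lookup p a \<noteq> 0 \<Longrightarrow> a \<in> S" "\<And>a. a \<in> S \<Longrightarrow> f a = c"
  shows "Poly_Mapping.lookup (push_forward f \<phi> p) c = (\<Sum>a\<in>S. \<phi> (Poly_Mapping.lookup p a))"
proof -
  have "Poly_Mapping.lookup (push_forward f \<phi> p) c =
      (\<Sum>a\<in>Poly_Mapping.keys p. if f a = c then \<phi> (Poly_Mapping.lookup p a) else 0)"
    by (simp add: push_forward_def lookup_sum lookup_single when_def)
  also have "\<dots> = (\<Sum>a\<in>Poly_Mapping.keys p \<inter> {a. f a = c}. \<phi> (Poly_Mapping.lookup p a))"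
    by (simp add: sum.inter_restrict)
  also have "\<dots> = (\<Sum>a\<in>S. \<phi> (Poly_Mapping.lookup p a))"
    using assms by (intro sum.mono_neutral_left) (auto simp: in_keys_iff additive_0)
  finally show ?thesis .
qed

end

lemma sum_single_lookup:
  fixes p :: "'a \<Rightarrow>\<^sub>0 'b::comm_monoid_add"
  shows "(\<Sum>a\<in>Poly_Mapping.keys p. Poly_Mapping.single a (Poly_Mapping.lookup p a)) = p"
  by (rule poly_mapping_eqI)
    (simp add: lookup_sum lookup_single when_def sum.delta in_keys_iff)

lemma push_forward_mult:
  fixes f :: "'a::monoid_add \<Rightarrow> 'c::monoid_add" and \<phi> :: "'b::comm_ring_1 \<Rightarrow> 'd::comm_ring_1"
  assumes add: "\<And>a b. \<phi> (a + b) = \<phi> a + \<phi> b" and mult: "\<And>a b. \<phi> (a * b) = \<phi> a * \<phi> b"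
    and f: "\<And>a b. f (a + b) = f a + f b"
  shows "push_forward f \<phi> (p * q) = push_forward f \<phi> p * push_forward f \<phi> q"
proof -
  let ?s = Poly_Mapping.single and ?l = Poly_Mapping.lookup and ?k = Poly_Mapping.keys
  have "p * q = (\<Sum>a\<in>?k p. ?s a (?l p a)) * (\<Sum>b\<in>?k q. ?s b (?l q b))"
    by (simp add: sum_single_lookup)
  also have "\<dots> = (\<Sum>a\<in>?k p. \<Sum>b\<in>?k q. ?s (a + b) (?l p a * ?l q b))"
    by (simp add: sum_product mult_single)
  finally have "push_forward f \<phi> (p * q) = (\<Sum>a\<in>?k p. \<Sum>b\<in>?k q. ?s (f a + f b) (\<phi> (?l p a) * \<phi> (?l q b)))"
    by (simp add: push_forward_sum[OF add] push_forward_single[OF add] mult f)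
  also have "\<dots> = push_forward f \<phi> p * push_forward f \<phi> q"
    by (simp add: push_forward_def sum_product mult_single)
  finally show ?thesis .
qed

lemma times_single_1:
  fixes p :: "'a::monoid_add \<Rightarrow>\<^sub>0 'b::comm_ring_1"
  shows "p * Poly_Mapping.single u 1 = push_forward (\<lambda>a. a + u) (\<lambda>x. x) p"
proof -
  have "p * Poly_Mapping.single u 1 =
      (\<Sum>a\<in>Poly_Mapping.keys p. Poly_Mapping.single a (Poly_Mapping.lookup p a)) * Poly_Mapping.single u 1"
    by (simp only: sum_single_lookup)
  then show ?thesis by (simp add: push_forward_def sum_distrib_right mult_single)
qed

lemma lookup_single_0_times:
  "Poly_Mapping.lookup (Poly_Mapping.single 0 s * p) a = s * Poly_Mapping.lookup p a"
  by (simp flip: mult_map_scale_conv_mult add: Poly_Mapping.map.rep_eq when_def)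

section \<open>The algebra of partial permutations\<close>

text \<open>
  The partial permutations of Ivanov and Kerov. Requiring in the type that \<open>d\<close> contains the points moved
  by \<open>g\<close> would complicate the multiplication; instead it is shown in \<open>keys_lifted_row\<close> that all those
  occurring in the lifted polynomials have this property.
\<close>

datatype partial_perm = Partial_Perm "nat set" "nat perm"

instantiation partial_perm :: monoid_add
begin

definition zero_partial_perm :: partial_perm where "0 = Partial_Perm {} 1"

fun plus_partial_perm :: "partial_perm \<Rightarrow> partial_perm \<Rightarrow> partial_perm"
  where "Partial_Perm d g + Partial_Perm e h = Partial_Perm (d \<union> e) (g * h)"

instance
proof
  fix a b c :: partial_perm
  show "a + b + c = a + (b + c)" by (cases a; cases b; cases c) (simp add: Un_assoc mult.assoc)
  show "0 + a = a" "a + 0 = a" by (cases a; simp add: zero_partial_perm_def)+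
qed

end

definition transposition :: "nat \<Rightarrow> nat \<Rightarrow> partial_perm"
  where "transposition a b = Partial_Perm {a, b} \<langle>a \<leftrightarrow> b\<rangle>"

definition lifted_jm :: "nat \<Rightarrow> partial_perm \<Rightarrow>\<^sub>0 'b::comm_ring_1"
  where "lifted_jm m = (\<Sum>j\<in>{1..<m}. Poly_Mapping.single (transposition j m) 1)"

definition lifted_row :: "'b::comm_ring_1 \<Rightarrow> nat \<Rightarrow> nat \<Rightarrow> partial_perm \<Rightarrow>\<^sub>0 'b"
  where "lifted_row t k n = hall_littlewood_row k (map lifted_jm [1..<n + 1]) (Poly_Mapping.single 0 t)"

lemma lifted_row_0: "k \<ge> 1 \<Longrightarrow> lifted_row t k 0 = 0"
  by (simp add: lifted_row_def hall_littlewood_row_Nil)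

lemma map_upt_Suc: "map f [1..<Suc n + 1] = map f [1..<n + 1] @ [f (Suc n)]"
  by simp

lemma lifted_row_1_Suc: "lifted_row t 1 (Suc n) = lifted_row t 1 n + lifted_jm (Suc n)"
  unfolding lifted_row_def map_upt_Suc by (rule hall_littlewood_row_1_snoc)

lemma lifted_row_Suc_Suc:
  "k \<ge> 1 \<Longrightarrow> lifted_row t (Suc k) (Suc n) = lifted_row t (Suc k) n +
    (lifted_row t k (Suc n) - Poly_Mapping.single 0 t * lifted_row t k n) * lifted_jm (Suc n)"
  unfolding lifted_row_def map_upt_Suc by (rule hall_littlewood_row_Suc_snoc)

fun conjugate :: "nat perm \<Rightarrow> partial_perm \<Rightarrow> partial_perm"
  where "conjugate \<pi> (Partial_Perm d g) = Partial_Perm (apply \<pi> ` d) (\<pi> * g * inverse \<pi>)"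

lemma conjugate_add: "conjugate \<pi> (a + b) = conjugate \<pi> a + conjugate \<pi> b"
proof -
  have "inverse \<pi> * (\<pi> * g) = g" for g by (simp flip: mult.assoc)
  then show ?thesis by (cases a; cases b) (simp add: image_Un mult.assoc)
qed

lemma conjugate_0 [simp]: "conjugate \<pi> 0 = 0"
  by (simp add: zero_partial_perm_def)

lemma conjugate_times: "conjugate (\<pi> * \<sigma>) a = conjugate \<pi> (conjugate \<sigma> a)"
  by (cases a) (simp add: apply_times image_comp mult.assoc)

lemma conjugate_1 [simp]: "conjugate 1 a = a"
  by (cases a) simp

lemma conjugate_eq_iff: "conjugate \<pi> a = conjugate \<pi> b \<longleftrightarrow> a = b"
  by (metis conjugate_times conjugate_1 perm.left_inverse)

lemma conjugate_swap_perm: "\<pi> * \<langle>a \<leftrightarrow> b\<rangle> * inverse \<pi> = \<langle>\<pi> \<langle>$\<rangle> a \<leftrightarrow> \<pi> \<langle>$\<rangle> b\<rangle>"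
proof -
  have "\<pi> * \<langle>a \<leftrightarrow> b\<rangle> = \<langle>\<pi> \<langle>$\<rangle> a \<leftrightarrow> \<pi> \<langle>$\<rangle> b\<rangle> * \<pi>"
  proof (rule perm_eqI)
    fix x
    show "(\<pi> * \<langle>a \<leftrightarrow> b\<rangle>) \<langle>$\<rangle> x = (\<langle>\<pi> \<langle>$\<rangle> a \<leftrightarrow> \<pi> \<langle>$\<rangle> b\<rangle> * \<pi>) \<langle>$\<rangle> x"
      by (cases "x = a"; cases "x = b") (simp_all add: apply_times apply_inj)
  qed
  then show ?thesis by (simp add: mult.assoc)
qed

lemma conjugate_transposition:
  "conjugate \<pi> (transposition a b) = transposition (\<pi> \<langle>$\<rangle> a) (\<pi> \<langle>$\<rangle> b)"
  by (simp add: transposition_def conjugate_swap_perm)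

lemma transposition_sym: "transposition a b = transposition b a"
  by (simp add: transposition_def insert_commute swap_sym)

lemma transposition_add:
  "transposition a b + transposition c d =
    transposition (\<langle>a \<leftrightarrow> b\<rangle> \<langle>$\<rangle> c) (\<langle>a \<leftrightarrow> b\<rangle> \<langle>$\<rangle> d) + transposition a b"
proof -
  let ?s = "\<langle>a \<leftrightarrow> b\<rangle>"
  have "?s * \<langle>c \<leftrightarrow> d\<rangle> = \<langle>?s \<langle>$\<rangle> c \<leftrightarrow> ?s \<langle>$\<rangle> d\<rangle> * ?s"
    using conjugate_swap_perm[of ?s c d] by (metis inverse_swap mult.assoc mult.right_neutral swap_self)
  moreover have "{a, b} \<union> {c, d} = {?s \<langle>$\<rangle> c, ?s \<langle>$\<rangle> d} \<union> {a, b}"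
    by (cases "c = a"; cases "c = b"; cases "d = a"; cases "d = b") auto
  ultimately show ?thesis by (simp add: transposition_def)
qed

text \<open>
  Conjugation by a transposition of two numbers below \<open>m\<close> permutes the summands of \<open>lifted_jm m\<close>.
\<close>

lemma lifted_jm_commute:
  assumes "i < m"
  shows "lifted_jm i * lifted_jm m = lifted_jm m * (lifted_jm i :: partial_perm \<Rightarrow>\<^sub>0 'b::comm_ring_1)"
proof -
  let ?s = "\<lambda>u. Poly_Mapping.single u (1::'b)"
  have "?s (transposition j i) * lifted_jm m = lifted_jm m * ?s (transposition j i)" if "j \<in> {1..<i}" for j
  proof -
    let ?\<tau> = "\<langle>j \<leftrightarrow> i\<rangle>"
    have m: "?\<tau> \<langle>$\<rangle> m = m" using that assms by simp
    have inv: "?\<tau> \<langle>$\<rangle> (?\<tau> \<langle>$\<rangle> l) = l" for l by (simp add: apply_sequence)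
    have into: "?\<tau> \<langle>$\<rangle> l \<in> {1..<m}" if "l \<in> {1..<m}" for l
      using that \<open>j \<in> {1..<i}\<close> assms by (cases "l = j"; cases "l = i") auto
    have "?s (transposition j i) * lifted_jm m =
        (\<Sum>l\<in>{1..<m}. ?s (transposition (?\<tau> \<langle>$\<rangle> l) m + transposition j i))"
      using m by (simp add: lifted_jm_def sum_distrib_left mult_single transposition_add[of j i])
    also have "\<dots> = (\<Sum>l\<in>{1..<m}. ?s (transposition l m + transposition j i))"
      by (rule sum.reindex_bij_witness[where i = "apply ?\<tau>" and j = "apply ?\<tau>"]) (simp_all only: inv into)
    also have "\<dots> = lifted_jm m * ?s (transposition j i)"
      by (simp add: lifted_jm_def sum_distrib_right mult_single)
    finally show ?thesis .
  qed
  then show ?thesis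
    unfolding lifted_jm_def[of i] sum_distrib_left sum_distrib_right by (intro sum.cong refl)
qed

abbreviation conjugate_algebra :: "nat perm \<Rightarrow> (partial_perm \<Rightarrow>\<^sub>0 'b) \<Rightarrow> (partial_perm \<Rightarrow>\<^sub>0 'b::comm_ring_1)"
  where "conjugate_algebra \<pi> \<equiv> push_forward (conjugate \<pi>) (\<lambda>x. x)"

lemma conjugate_lifted_jm:
  "conjugate_algebra \<pi> (lifted_jm m) =
    (\<Sum>j\<in>{1..<m}. Poly_Mapping.single (transposition (\<pi> \<langle>$\<rangle> j) (\<pi> \<langle>$\<rangle> m)) (1::'b::comm_ring_1))"
  by (simp add: lifted_jm_def push_forward_sum push_forward_single conjugate_transposition)

text \<open>
  Up to \<open>n = i + 1\<close> this is \<open>hall_littlewood_row_exchange\<close>; the variables beyond are fixed by the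
  conjugation.
\<close>

lemma lifted_row_adjacent_swap:
  assumes "1 \<le> i" "i < n" "k \<ge> 1"
  shows "conjugate_algebra \<langle>i \<leftrightarrow> Suc i\<rangle> (lifted_row t k n) = lifted_row t k n"
proof -
  let ?\<tau> = "\<langle>i \<leftrightarrow> Suc i\<rangle>"
  let ?F = "conjugate_algebra ?\<tau> :: (partial_perm \<Rightarrow>\<^sub>0 'a) \<Rightarrow> _"
  let ?s = "Poly_Mapping.single (transposition i (Suc i)) (1::'a)"
  let ?t = "Poly_Mapping.single 0 t :: partial_perm \<Rightarrow>\<^sub>0 'a"
  have add: "?F (a + b) = ?F a + ?F b" and diff: "?F (a - b) = ?F a - ?F b"
    and mult: "?F (a * b) = ?F a * ?F b" for a b
    by (simp_all add: push_forward_add push_forward_diff push_forward_mult conjugate_add)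
  have t: "?F ?t = ?t" by (simp add: push_forward_single)
  have fixed: "?F (lifted_jm m) = lifted_jm m" if "m \<noteq> i" "m \<noteq> Suc i" for m
  proof -
    have inv: "?\<tau> \<langle>$\<rangle> (?\<tau> \<langle>$\<rangle> l) = l" for l by (simp add: apply_sequence)
    have into: "?\<tau> \<langle>$\<rangle> l \<in> {1..<m}" if "l \<in> {1..<m}" for l
      using that \<open>m \<noteq> i\<close> \<open>m \<noteq> Suc i\<close> assms by (cases "l = i"; cases "l = Suc i") auto
    have m: "?\<tau> \<langle>$\<rangle> m = m" using that by simp
    show ?thesis unfolding conjugate_lifted_jm m unfolding lifted_jm_def
      by (rule sum.reindex_bij_witness[where i = "apply ?\<tau>" and j = "apply ?\<tau>"]) (simp_all only: inv into)
  qed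
  have jm_Suc: "lifted_jm (Suc i) = (\<Sum>j\<in>{1..<i}. Poly_Mapping.single (transposition j (Suc i)) (1::'a)) + ?s"
    using assms(1) by (simp add: lifted_jm_def)
  have x: "?F (lifted_jm i) = lifted_jm (Suc i) - ?s"
    unfolding conjugate_lifted_jm jm_Suc by simp
  have y: "?F (lifted_jm (Suc i)) = lifted_jm i + ?s"
    unfolding conjugate_lifted_jm using assms(1)
    by (simp add: lifted_jm_def transposition_sym[of "Suc i"])
  have s: "?s * ?F (lifted_jm i) = lifted_jm i * ?s"
    unfolding conjugate_lifted_jm unfolding lifted_jm_def sum_distrib_left sum_distrib_right
    by (intro sum.cong refl) (simp add: mult_single transposition_add[of i "Suc i"])
  have xs: "?F x = x" if "x \<in> set (map lifted_jm [1..<i])" for x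
    using that fixed by auto
  have base: "?F (lifted_row t k (Suc i)) = lifted_row t k (Suc i)" if "k \<ge> 1" for k
    using hall_littlewood_row_exchange[of ?F "map lifted_jm [1..<i]" ?t "lifted_jm i" "lifted_jm (Suc i)" ?s,
        OF add diff mult xs t x y s lifted_jm_commute that] assms(1)
    by (simp add: lifted_row_def)
  have "Suc i \<le> n" using assms by simp
  then show ?thesis using \<open>k \<ge> 1\<close>
  proof (induction n arbitrary: k rule: dec_induct)
    case base
    then show ?case using \<open>\<And>k. k \<ge> 1 \<Longrightarrow> ?F (lifted_row t k (Suc i)) = lifted_row t k (Suc i)\<close> by blast
  next
    case (step n)
    have fx: "?F (lifted_jm (Suc n)) = lifted_jm (Suc n)" using step by (intro fixed) auto
    from \<open>k \<ge> 1\<close> show ?case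
    proof (induction k rule: dec_induct)
      case base
      show ?case using step.IH[of 1] fx by (simp only: lifted_row_1_Suc add order_refl)
    next
      case (step k)
      then show ?case using \<open>\<And>k. k \<ge> 1 \<Longrightarrow> ?F (lifted_row t k n) = lifted_row t k n\<close> fx t
        by (simp add: lifted_row_Suc_Suc add diff mult)
    qed
  qed
qed

lemma perm_swaps_induct [consumes 1, case_names one swap]:
  assumes "affected \<pi> \<subseteq> A" and "P 1"
    and "\<And>a b \<pi>. a \<in> A \<Longrightarrow> b \<in> A \<Longrightarrow> a \<noteq> b \<Longrightarrow> P \<pi> \<Longrightarrow> P (\<langle>a \<leftrightarrow> b\<rangle> * \<pi>)"
  shows "P \<pi>"
  using assms(1)
proof (induction "card (affected \<pi>)" arbitrary: \<pi> rule: less_induct)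
  case less
  show ?case
  proof (cases "\<pi> = 1")
    case False
    then obtain a where a: "a \<in> affected \<pi>" by fastforce
    define b where "b = \<pi> \<langle>$\<rangle> a"
    have ab: "a \<noteq> b" "b \<in> affected \<pi>" using a by (auto simp: b_def in_affected apply_inj)
    let ?\<sigma> = "\<langle>a \<leftrightarrow> b\<rangle> * \<pi>"
    have "a \<notin> affected ?\<sigma>" by (simp add: in_affected apply_times b_def)
    moreover have "affected ?\<sigma> \<subseteq> affected \<pi>"
      using affected_times[of "\<langle>a \<leftrightarrow> b\<rangle>" \<pi>] affected_swap[OF ab(1)] a ab(2) by auto
    ultimately have "affected ?\<sigma> \<subset> affected \<pi>" using a by auto
    then have "P ?\<sigma>" using less by (meson finite_affected psubset_card_mono subset_trans psubset_imp_subset)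
    then have "P (\<langle>a \<leftrightarrow> b\<rangle> * ?\<sigma>)" using less.prems a ab by (metis assms(3) subsetD)
    moreover have "\<langle>a \<leftrightarrow> b\<rangle> * ?\<sigma> = \<pi>" by (simp flip: mult.assoc)
    ultimately show ?thesis by (simp only:)
  qed (use assms(2) in simp)
qed

text \<open>
  Every transposition is obtained from an adjacent one by conjugating with adjacent ones, and every
  permutation is a product of transpositions.
\<close>

lemma lookup_lifted_row_conjugate:
  assumes "affected \<pi> \<subseteq> {1..n}" "k \<ge> 1"
  shows "Poly_Mapping.lookup (lifted_row t k n) (conjugate \<pi> a) = Poly_Mapping.lookup (lifted_row t k n) a"
proof -
  define inv where "inv \<pi> \<longleftrightarrow> (\<forall>a. Poly_Mapping.lookup (lifted_row t k n) (conjugate \<pi> a) =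
    Poly_Mapping.lookup (lifted_row t k n) a)" for \<pi>
  have times: "inv (\<pi> * \<sigma>)" if "inv \<pi>" "inv \<sigma>" for \<pi> \<sigma>
    using that by (simp add: inv_def conjugate_times)
  have adjacent: "inv \<langle>i \<leftrightarrow> Suc i\<rangle>" if "1 \<le> i" "i < n" for i
    unfolding inv_def
  proof
    fix a
    have "Poly_Mapping.lookup (lifted_row t k n) (conjugate \<langle>i \<leftrightarrow> Suc i\<rangle> a) =
        Poly_Mapping.lookup (conjugate_algebra \<langle>i \<leftrightarrow> Suc i\<rangle> (lifted_row t k n)) (conjugate \<langle>i \<leftrightarrow> Suc i\<rangle> a)"
      using lifted_row_adjacent_swap[OF that assms(2), of t] by simp
    also have "\<dots> = (\<Sum>a\<in>{a}. Poly_Mapping.lookup (lifted_row t k n) a)"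
      by (rule lookup_push_forward) (auto simp: conjugate_eq_iff)
    finally show "Poly_Mapping.lookup (lifted_row t k n) (conjugate \<langle>i \<leftrightarrow> Suc i\<rangle> a) =
        Poly_Mapping.lookup (lifted_row t k n) a" by simp
  qed
  have transpositions: "inv \<langle>i \<leftrightarrow> j\<rangle>" if "1 \<le> i" "i < j" "j \<le> n" for i j
  proof -
    have "Suc i \<le> j" using that by simp
    then show ?thesis using \<open>j \<le> n\<close>
    proof (induction j rule: dec_induct)
      case base
      then show ?case using adjacent that by simp
    next
      case (step j)
      have "\<langle>i \<leftrightarrow> Suc j\<rangle> = \<langle>j \<leftrightarrow> Suc j\<rangle> * \<langle>i \<leftrightarrow> j\<rangle> * \<langle>j \<leftrightarrow> Suc j\<rangle>"
        using conjugate_swap_perm[of "\<langle>j \<leftrightarrow> Suc j\<rangle>" i j] step by simp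
      then show ?case using step times adjacent[of j] that by simp
    qed
  qed
  from assms(1) have "inv \<pi>"
  proof (induction rule: perm_swaps_induct)
    case one
    then show ?case by (simp add: inv_def)
  next
    case (swap a b \<pi>)
    have "inv \<langle>a \<leftrightarrow> b\<rangle>"
    proof (cases "a < b")
      case True
      then show ?thesis using swap.hyps by (intro transpositions) auto
    next
      case False
      then have "inv \<langle>b \<leftrightarrow> a\<rangle>" using swap.hyps by (intro transpositions) auto
      then show ?thesis by (simp add: swap_sym)
    qed
    then show ?case using swap.IH times by blast
  qed
  then show ?thesis by (simp add: inv_def)
qed

text \<open>
  The four sets are those whose union with \<open>{a, b}\<close> is \<open>D\<close>.
\<close>

lemma lookup_times_transposition:
  fixes p :: "partial_perm \<Rightarrow>\<^sub>0 'b::comm_ring_1" and g :: "nat perm"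
  assumes "a \<noteq> b"
  defines "h \<equiv> g * \<langle>a \<leftrightarrow> b\<rangle>"
  shows "Poly_Mapping.lookup (p * Poly_Mapping.single (transposition a b) 1) (Partial_Perm D g) =
    (if a \<in> D \<and> b \<in> D then
      Poly_Mapping.lookup p (Partial_Perm D h) + Poly_Mapping.lookup p (Partial_Perm (D - {a}) h) +
      Poly_Mapping.lookup p (Partial_Perm (D - {b}) h) + Poly_Mapping.lookup p (Partial_Perm (D - {a, b}) h)
     else 0)"
proof -
  let ?S = "if a \<in> D \<and> b \<in> D then (\<lambda>d. Partial_Perm d h) ` {D, D - {a}, D - {b}, D - {a, b}} else {}"
  have h: "h' * \<langle>a \<leftrightarrow> b\<rangle> = g \<longleftrightarrow> h' = h" for h'
    unfolding h_def by (metis mult.assoc mult.right_neutral swap_self)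
  have "Poly_Mapping.lookup (p * Poly_Mapping.single (transposition a b) 1) (Partial_Perm D g) =
      (\<Sum>u\<in>?S. Poly_Mapping.lookup p u)"
    unfolding times_single_1
  proof (rule lookup_push_forward)
    fix u assume "u + transposition a b = Partial_Perm D g"
    then obtain d where d: "u = Partial_Perm d h" "d \<union> {a, b} = D"
      by (cases u) (auto simp: transposition_def h)
    then have "d = D \<or> d = D - {a} \<or> d = D - {b} \<or> d = D - {a, b}" by blast
    then show "u \<in> ?S" using d by auto
  next
    fix u assume "u \<in> ?S"
    then show "u + transposition a b = Partial_Perm D g"
      by (auto simp: transposition_def h split: if_splits)
  qed auto
  also have "\<dots> = (if a \<in> D \<and> b \<in> D then
      Poly_Mapping.lookup p (Partial_Perm D h) + Poly_Mapping.lookup p (Partial_Perm (D - {a}) h) +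
      Poly_Mapping.lookup p (Partial_Perm (D - {b}) h) + Poly_Mapping.lookup p (Partial_Perm (D - {a, b}) h)
     else 0)"
  proof (cases "a \<in> D \<and> b \<in> D")
    case True
    then have "D \<noteq> D - {a}" "D \<noteq> D - {b}" "D \<noteq> D - {a, b}" "D - {a} \<noteq> D - {b}"
      "D - {a} \<noteq> D - {a, b}" "D - {b} \<noteq> D - {a, b}" using assms(1) by auto
    then have "sum (Poly_Mapping.lookup p) ((\<lambda>d. Partial_Perm d h) ` {D, D - {a}, D - {b}, D - {a, b}}) =
        (\<Sum>d\<in>{D, D - {a}, D - {b}, D - {a, b}}. Poly_Mapping.lookup p (Partial_Perm d h))"
      by (subst sum.reindex) (auto simp: inj_on_def)
    then show ?thesis using True \<open>D \<noteq> D - {a}\<close> \<open>D \<noteq> D - {b}\<close> \<open>D \<noteq> D - {a, b}\<close> \<open>D - {a} \<noteq> D - {b}\<close>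
      \<open>D - {a} \<noteq> D - {a, b}\<close> \<open>D - {b} \<noteq> D - {a, b}\<close> by (simp add: add.assoc)
  next
    case False
    then show ?thesis by (simp only: False if_False sum.empty)
  qed
  finally show ?thesis .
qed

lemma lookup_times_lifted_jm:
  fixes p :: "partial_perm \<Rightarrow>\<^sub>0 'b::comm_ring_1"
  assumes "D \<subseteq> {1..m}"
  shows "Poly_Mapping.lookup (p * lifted_jm m) (Partial_Perm D g) =
    (if m \<in> D then (\<Sum>j\<in>D - {m}. let h = g * \<langle>j \<leftrightarrow> m\<rangle> in
      Poly_Mapping.lookup p (Partial_Perm D h) + Poly_Mapping.lookup p (Partial_Perm (D - {j}) h) +
      Poly_Mapping.lookup p (Partial_Perm (D - {m}) h) + Poly_Mapping.lookup p (Partial_Perm (D - {j, m}) h))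
     else 0)"
proof -
  let ?f = "\<lambda>j. Poly_Mapping.lookup (p * Poly_Mapping.single (transposition j m) 1) (Partial_Perm D g)"
  have "Poly_Mapping.lookup (p * lifted_jm m) (Partial_Perm D g) = (\<Sum>j\<in>{1..<m}. ?f j)"
    by (simp add: lifted_jm_def sum_distrib_left lookup_sum)
  also have "\<dots> = (if m \<in> D then (\<Sum>j\<in>D - {m}. ?f j) else 0)"
  proof (cases "m \<in> D")
    case True
    have "(\<Sum>j\<in>{1..<m}. ?f j) = (\<Sum>j\<in>D - {m}. ?f j)"
      using assms by (intro sum.mono_neutral_right) (auto simp: lookup_times_transposition le_neq_implies_less)
    then show ?thesis using True by simp
  qed (auto simp: lookup_times_transposition intro!: sum.neutral)
  also have "\<dots> = (if m \<in> D then (\<Sum>j\<in>D - {m}. let h = g * \<langle>j \<leftrightarrow> m\<rangle> in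
      Poly_Mapping.lookup p (Partial_Perm D h) + Poly_Mapping.lookup p (Partial_Perm (D - {j}) h) +
      Poly_Mapping.lookup p (Partial_Perm (D - {m}) h) + Poly_Mapping.lookup p (Partial_Perm (D - {j, m}) h))
     else 0)"
    by (auto simp: lookup_times_transposition Let_def intro!: sum.cong)
  finally show ?thesis .
qed

lemma keys_lifted_row:
  assumes "k \<ge> 1"
  shows "Poly_Mapping.keys (lifted_row t k n) \<subseteq> {Partial_Perm d g | d g. affected g \<subseteq> d \<and> d \<subseteq> {1..n}}"
    (is "_ \<subseteq> ?W")
proof -
  have plus: "a + b \<in> ?W" if "a \<in> ?W" "b \<in> ?W" for a b
  proof -
    obtain d g where "a = Partial_Perm d g" "affected g \<subseteq> d" "d \<subseteq> {1..n}"
      using \<open>a \<in> ?W\<close> by auto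
    moreover obtain e h where "b = Partial_Perm e h" "affected h \<subseteq> e" "e \<subseteq> {1..n}"
      using \<open>b \<in> ?W\<close> by auto
    moreover have "affected (g * h) \<subseteq> affected g \<union> affected h" by (rule affected_times)
    ultimately have "a + b = Partial_Perm (d \<union> e) (g * h)" "affected (g * h) \<subseteq> d \<union> e"
      "d \<union> e \<subseteq> {1..n}" by (simp, blast, blast)
    then show ?thesis by blast
  qed
  show ?thesis
    unfolding lifted_row_def
  proof (rule hall_littlewood_row_invariant[where P = "\<lambda>p. Poly_Mapping.keys p \<subseteq> ?W"])
    show "Poly_Mapping.keys (Poly_Mapping.single (0 :: partial_perm) t) \<subseteq> ?W"
      by (auto simp: zero_partial_perm_def)
    show "Poly_Mapping.keys x \<subseteq> ?W" if "x \<in> set (map lifted_jm [1..<n + 1])" for x :: "partial_perm \<Rightarrow>\<^sub>0 'a"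
    proof -
      obtain m where m: "m \<in> {1..n}" "x = lifted_jm m"
        using \<open>x \<in> _\<close> by (fastforce simp: less_Suc_eq_le simp del: upt_Suc)
      have "transposition j m \<in> ?W" if "j \<in> {1..<m}" for j
        using that m(1) by (auto simp: transposition_def affected_swap)
      then have "(\<Union>j\<in>{1..<m}. Poly_Mapping.keys (Poly_Mapping.single (transposition j m) (1::'a))) \<subseteq> ?W"
        by (intro UN_least) simp
      then show ?thesis unfolding m(2) lifted_jm_def by (rule order_trans[OF Poly_Mapping.keys_sum])
    qed
    show "Poly_Mapping.keys (a + b) \<subseteq> ?W" if "Poly_Mapping.keys a \<subseteq> ?W" "Poly_Mapping.keys b \<subseteq> ?W"
      for a b :: "partial_perm \<Rightarrow>\<^sub>0 'a"
      using that Poly_Mapping.keys_add[of a b] by blast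
    show "Poly_Mapping.keys (a - b) \<subseteq> ?W" if "Poly_Mapping.keys a \<subseteq> ?W" "Poly_Mapping.keys b \<subseteq> ?W"
      for a b :: "partial_perm \<Rightarrow>\<^sub>0 'a"
      using that Poly_Mapping.keys_diff[of a b] by blast
    show "Poly_Mapping.keys (a * b) \<subseteq> ?W" if "Poly_Mapping.keys a \<subseteq> ?W" "Poly_Mapping.keys b \<subseteq> ?W"
      for a b :: "partial_perm \<Rightarrow>\<^sub>0 'a"
    proof
      fix c assume "c \<in> Poly_Mapping.keys (a * b)"
      then obtain u v where "c = u + v" "u \<in> Poly_Mapping.keys a" "v \<in> Poly_Mapping.keys b"
        using Poly_Mapping.keys_mult[of a b] by blast
      then show "c \<in> ?W" using plus[OF subsetD[OF that(1)] subsetD[OF that(2)]] by (simp only:)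
    qed
  qed (use assms in auto)
qed

lemma lookup_lifted_row_eq_0:
  assumes "k \<ge> 1" "\<not> (affected g \<subseteq> d \<and> d \<subseteq> {1..n})"
  shows "Poly_Mapping.lookup (lifted_row t k n) (Partial_Perm d g) = 0"
proof -
  have "Partial_Perm d g \<notin> Poly_Mapping.keys (lifted_row t k n)"
    using keys_lifted_row[OF assms(1), of t n] assms(2) by blast
  then show ?thesis by (simp add: in_keys_iff)
qed

lemma lookup_lifted_row_mono:
  assumes "k \<ge> 1" "D \<subseteq> {1..m}" "m \<le> n"
  shows "Poly_Mapping.lookup (lifted_row t k n) (Partial_Perm D g) =
    Poly_Mapping.lookup (lifted_row t k m) (Partial_Perm D g)"
  using assms(3)
proof (induction n rule: dec_induct)
  case (step n)
  have D: "D \<subseteq> {1..Suc n}" "Suc n \<notin> D" using assms(2) step by fastforce+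
  have "Poly_Mapping.lookup (p * lifted_jm (Suc n)) (Partial_Perm D g) = 0" for p :: "partial_perm \<Rightarrow>\<^sub>0 'a"
    using D by (simp add: lookup_times_lifted_jm)
  from this[of 1] this have "Poly_Mapping.lookup (lifted_row t k (Suc n)) (Partial_Perm D g) =
      Poly_Mapping.lookup (lifted_row t k n) (Partial_Perm D g)"
    using assms(1) by (cases k; cases "k = 1") (simp_all add: lifted_row_1_Suc[simplified] lifted_row_Suc_Suc lookup_add)
  then show ?case using step by simp
qed simp

text \<open>
  The number \<open>Max (insert 0 D)\<close> is the least \<open>n\<close> such that \<open>D \<subseteq> {1..n}\<close>, for \<open>D\<close> a finite set of positive
  numbers. By \<open>lookup_lifted_row\<close> every larger \<open>n\<close> gives the same coefficient.
\<close>

definition coefficient :: "'b::comm_ring_1 \<Rightarrow> nat \<Rightarrow> nat set \<Rightarrow> nat perm \<Rightarrow> 'b"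
  where "coefficient t k D g = Poly_Mapping.lookup (lifted_row t k (Max (insert 0 D))) (Partial_Perm D g)"

lemma lookup_lifted_row:
  assumes "k \<ge> 1" "D \<subseteq> {1..n}"
  shows "Poly_Mapping.lookup (lifted_row t k n) (Partial_Perm D g) = coefficient t k D g"
proof -
  have fin: "finite D" using assms(2) finite_subset by blast
  then have "D \<subseteq> {1..Max (insert 0 D)}" using assms(2) by auto
  moreover have "Max (insert 0 D) \<le> n" using fin assms(2) by auto
  ultimately show ?thesis
    unfolding coefficient_def using assms(1) by (intro lookup_lifted_row_mono)
qed

lemma coefficient_eq_0:
  assumes "k \<ge> 1" "\<not> affected g \<subseteq> D"
  shows "coefficient t k D g = 0"
  unfolding coefficient_def using assms by (intro lookup_lifted_row_eq_0) auto

lemma coefficient_conjugate: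
  assumes "finite D" "0 \<notin> D" "affected \<pi> \<subseteq> A" "finite A" "0 \<notin> A" "k \<ge> 1"
  shows "coefficient t k (apply \<pi> ` D) (\<pi> * g * inverse \<pi>) = coefficient t k D g"
proof -
  have "0 \<notin> apply \<pi> ` D"
    using assms(2,3,5) apply_inj[of \<pi>] by (metis imageE in_affected subsetD)
  then have fin: "finite (A \<union> D \<union> apply \<pi> ` D)" "0 \<notin> A \<union> D \<union> apply \<pi> ` D"
    using assms by auto
  define n where "n = Max (insert 0 (A \<union> D \<union> apply \<pi> ` D))"
  have "x \<in> {1..n}" if "x \<in> A \<union> D \<union> apply \<pi> ` D" for x
  proof -
    have "x \<le> n" unfolding n_def using fin that by (intro Max_ge) auto
    moreover have "x \<noteq> 0" using that fin(2) by metis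
    ultimately show ?thesis by simp
  qed
  then have n: "A \<subseteq> {1..n}" "D \<subseteq> {1..n}" "apply \<pi> ` D \<subseteq> {1..n}" by blast+
  have "affected \<pi> \<subseteq> {1..n}" using assms(3) n(1) by blast
  from lookup_lifted_row_conjugate[OF this assms(6), of t "Partial_Perm D g"]
  show ?thesis
    unfolding conjugate.simps lookup_lifted_row[OF assms(6) n(2)] lookup_lifted_row[OF assms(6) n(3)] .
qed

text \<open>
  Partial permutations on sets containing \<open>m\<close> do not occur in the lifted polynomial for \<open>m - 1\<close>, while the
  others have the same coefficient in the polynomials for \<open>m\<close> and for \<open>m - 1\<close>. Hence the factor \<open>1 - t\<close>
  at the sets without \<open>m\<close>.
\<close>

lemma coefficient_Suc_Max:
  assumes "k \<ge> 1" "D \<subseteq> {1..m}" "m \<in> D"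
  shows "coefficient t (Suc k) D g = (\<Sum>j\<in>D - {m}. let h = g * \<langle>j \<leftrightarrow> m\<rangle> in
      coefficient t k D h + coefficient t k (D - {j}) h +
      (1 - t) * (coefficient t k (D - {m}) h + coefficient t k (D - {j, m}) h))"
proof -
  obtain n where m: "m = Suc n" using assms by (cases m) auto
  let ?p = "lifted_row t k (Suc n) - Poly_Mapping.single 0 t * lifted_row t k n"
  have with_m: "Poly_Mapping.lookup ?p (Partial_Perm d h) = coefficient t k d h"
    if "d \<subseteq> {1..Suc n}" "Suc n \<in> d" for d h
  proof -
    have "\<not> d \<subseteq> {1..n}" using that by auto
    then show ?thesis using that
      by (simp add: lookup_minus lookup_single_0_times lookup_lifted_row[OF assms(1)] lookup_lifted_row_eq_0[OF assms(1)])
  qed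
  have without_m: "Poly_Mapping.lookup ?p (Partial_Perm d h) = (1 - t) * coefficient t k d h"
    if "d \<subseteq> {1..n}" for d h
  proof -
    have "d \<subseteq> {1..Suc n}" using that by auto
    then show ?thesis using that
      by (simp add: lookup_minus lookup_single_0_times lookup_lifted_row[OF assms(1)] algebra_simps)
  qed
  have "coefficient t (Suc k) D g = Poly_Mapping.lookup (lifted_row t (Suc k) (Suc n)) (Partial_Perm D g)"
    using assms m by (simp add: lookup_lifted_row)
  also have "\<dots> = Poly_Mapping.lookup (lifted_row t (Suc k) n) (Partial_Perm D g) +
      Poly_Mapping.lookup (?p * lifted_jm (Suc n)) (Partial_Perm D g)"
    by (simp add: lifted_row_Suc_Suc[OF assms(1)] lookup_add)
  also have "Poly_Mapping.lookup (lifted_row t (Suc k) n) (Partial_Perm D g) = 0"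
    using assms m by (intro lookup_lifted_row_eq_0) auto
  also have "Poly_Mapping.lookup (?p * lifted_jm (Suc n)) (Partial_Perm D g) =
      (\<Sum>j\<in>D - {m}. let h = g * \<langle>j \<leftrightarrow> m\<rangle> in
        Poly_Mapping.lookup ?p (Partial_Perm D h) + Poly_Mapping.lookup ?p (Partial_Perm (D - {j}) h) +
        Poly_Mapping.lookup ?p (Partial_Perm (D - {m}) h) + Poly_Mapping.lookup ?p (Partial_Perm (D - {j, m}) h))"
    using assms(2,3) m by (subst lookup_times_lifted_jm) simp_all
  also have "\<dots> = (\<Sum>j\<in>D - {m}. let h = g * \<langle>j \<leftrightarrow> m\<rangle> in
      coefficient t k D h + coefficient t k (D - {j}) h +
      (1 - t) * (coefficient t k (D - {m}) h + coefficient t k (D - {j, m}) h))"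
  proof (rule sum.cong[OF refl])
    fix j assume j: "j \<in> D - {m}"
    have D: "D \<subseteq> {1..Suc n}" "Suc n \<in> D" "D - {j} \<subseteq> {1..Suc n}" "Suc n \<in> D - {j}"
      "D - {m} \<subseteq> {1..n}" "D - {j, m} \<subseteq> {1..n}"
      using assms(2,3) m j by (auto simp: le_Suc_eq)
    show "(let h = g * \<langle>j \<leftrightarrow> m\<rangle> in
        Poly_Mapping.lookup ?p (Partial_Perm D h) + Poly_Mapping.lookup ?p (Partial_Perm (D - {j}) h) +
        Poly_Mapping.lookup ?p (Partial_Perm (D - {m}) h) + Poly_Mapping.lookup ?p (Partial_Perm (D - {j, m}) h)) =
      (let h = g * \<langle>j \<leftrightarrow> m\<rangle> in
        coefficient t k D h + coefficient t k (D - {j}) h +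
        (1 - t) * (coefficient t k (D - {m}) h + coefficient t k (D - {j, m}) h))"
      unfolding Let_def with_m[OF D(1,2)] with_m[OF D(3,4)] without_m[OF D(5)] without_m[OF D(6)]
      by (simp add: distrib_left add.assoc)
  qed
  finally show ?thesis by simp
qed

text \<open>
  Conjugation by the transposition of \<open>a\<close> and the maximum reduces this to \<open>coefficient_Suc_Max\<close>. The freedom
  to choose \<open>a\<close> is what makes the recurrences available for every part of a partition.
\<close>

lemma coefficient_Suc:
  assumes "k \<ge> 1" "finite D" "0 \<notin> D" "a \<in> D"
  shows "coefficient t (Suc k) D g = (\<Sum>j\<in>D - {a}. let h = g * \<langle>j \<leftrightarrow> a\<rangle> in
      coefficient t k D h + coefficient t k (D - {j}) h +
      (1 - t) * (coefficient t k (D - {a}) h + coefficient t k (D - {j, a}) h))"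
proof -
  define m where "m = Max D"
  have "m \<in> D" unfolding m_def using assms(2,4) by (intro Max_in) auto
  moreover have "x \<in> {1..m}" if "x \<in> D" for x
    using that assms(2,3) by (cases "x = 0") (auto simp: m_def)
  ultimately have m: "m \<in> D" "D \<subseteq> {1..m}" by auto
  let ?\<pi> = "\<langle>a \<leftrightarrow> m\<rangle>"
  have inv: "?\<pi> \<langle>$\<rangle> (?\<pi> \<langle>$\<rangle> l) = l" for l by (simp add: apply_sequence)
  have mem: "?\<pi> \<langle>$\<rangle> l \<in> D \<longleftrightarrow> l \<in> D" for l
    using assms(4) m(1) by (cases "l = a"; cases "l = m") auto
  have "l \<in> apply ?\<pi> ` D" if "l \<in> D" for l
    using mem[of l] inv[of l] that by (metis imageI)
  then have im: "apply ?\<pi> ` D = D" using mem by blast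
  have aff: "affected ?\<pi> \<subseteq> D" using assms(4) m(1) by (cases "a = m") (auto simp: affected_swap)
  have conj: "coefficient t k (apply ?\<pi> ` d) (?\<pi> * g * ?\<pi>) = coefficient t k d g"
    if "d \<subseteq> D" "k \<ge> 1" for d g k
    using coefficient_conjugate[of d ?\<pi> D k t g] that assms(2,3) aff finite_subset by auto
  let ?T = "\<lambda>m g j. let h = g * \<langle>j \<leftrightarrow> m\<rangle> in
      coefficient t k D h + coefficient t k (D - {j}) h +
      (1 - t) * (coefficient t k (D - {m}) h + coefficient t k (D - {j, m}) h)"
  have "coefficient t (Suc k) D g = coefficient t (Suc k) D (?\<pi> * g * ?\<pi>)"
    using conj[of D "Suc k" g] im by simp
  also have "\<dots> = (\<Sum>j\<in>D - {m}. ?T m (?\<pi> * g * ?\<pi>) j)"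
    by (rule coefficient_Suc_Max[OF assms(1) m(2,1)])
  also have "\<dots> = (\<Sum>j\<in>D - {a}. ?T a g j)"
  proof (rule sum.reindex_bij_witness[where i = "apply ?\<pi>" and j = "apply ?\<pi>"])
    fix j assume j: "j \<in> D - {m}"
    show "?\<pi> \<langle>$\<rangle> (?\<pi> \<langle>$\<rangle> j) = j" by (rule inv)
    show "?\<pi> \<langle>$\<rangle> j \<in> D - {a}" using j mem by auto
    let ?i = "?\<pi> \<langle>$\<rangle> j" and ?h = "g * \<langle>?\<pi> \<langle>$\<rangle> j \<leftrightarrow> a\<rangle>"
    have "?\<pi> * \<langle>?i \<leftrightarrow> a\<rangle> * inverse ?\<pi> = \<langle>?\<pi> \<langle>$\<rangle> ?i \<leftrightarrow> ?\<pi> \<langle>$\<rangle> a\<rangle>" by (rule conjugate_swap_perm)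
    then have "?\<pi> * \<langle>?i \<leftrightarrow> a\<rangle> * ?\<pi> = \<langle>j \<leftrightarrow> m\<rangle>" by (simp add: inv)
    then have h: "?\<pi> * g * ?\<pi> * \<langle>j \<leftrightarrow> m\<rangle> = ?\<pi> * ?h * ?\<pi>"
      by (metis (no_types, lifting) mult.assoc mult.left_neutral swap_self)
    have inj: "inj (apply ?\<pi>)" by (rule bij_is_inj) simp
    have im': "apply ?\<pi> ` (D - {?i}) = D - {j}" "apply ?\<pi> ` (D - {a}) = D - {m}" "apply ?\<pi> ` (D - {?i, a}) = D - {j, m}"
      by (simp_all add: image_set_diff[OF inj] im inv)
    show "?T a g ?i = ?T m (?\<pi> * g * ?\<pi>) j"
      unfolding Let_def h
      using conj[of D k ?h] conj[of "D - {?i}" k ?h] conj[of "D - {a}" k ?h] conj[of "D - {?i, a}" k ?h]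
      unfolding im im' using assms(1) by (simp add: subset_iff)
  next
    fix j assume j: "j \<in> D - {a}"
    show "?\<pi> \<langle>$\<rangle> (?\<pi> \<langle>$\<rangle> j) = j" by (rule inv)
    show "?\<pi> \<langle>$\<rangle> j \<in> D - {m}" using j mem by auto
  qed
  finally show ?thesis .
qed

section \<open>Recurrences for the class coefficients\<close>

text \<open>
  Any permutation of cycle type \<open>\<rho>\<close> may be chosen, by \<open>coefficient_eq_class_coefficient\<close>.
\<close>

definition class_coefficient :: "'b::comm_ring_1 \<Rightarrow> nat \<Rightarrow> nat multiset \<Rightarrow> 'b"
  where "class_coefficient t k \<rho> =
    (let (n, g) = (SOME (n, g). affected g \<subseteq> {1..n} \<and> cycle_type_on {1..n} g = \<rho>) in coefficient t k {1..n} g)"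

lemma coefficient_eq_class_coefficient:
  assumes "k \<ge> 1" "finite D" "0 \<notin> D" "affected g \<subseteq> D"
  shows "coefficient t k D g = class_coefficient t k (cycle_type_on D g)"
proof -
  let ?\<rho> = "cycle_type_on D g"
  let ?P = "\<lambda>(n::nat, g). affected g \<subseteq> {1..n} \<and> cycle_type_on {1..n} g = ?\<rho>"
  obtain n g' where ng: "(SOME x. ?P x) = (n, g')" by fastforce
  obtain n0 g0 where "affected g0 \<subseteq> {1..n0::nat}" "cycle_type_on {1..n0} g0 = ?\<rho>"
    using ex_perm_of_cycle_type[OF cycle_type_on_partition[OF assms(2)]] by blast
  then have "?P (n0, g0)" by simp
  then have "?P (SOME x. ?P x)" by (rule someI)
  then have g': "affected g' \<subseteq> {1..n}" "cycle_type_on {1..n} g' = ?\<rho>" unfolding ng prod.case by blast+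
  obtain \<pi> where \<pi>: "affected \<pi> \<subseteq> D \<union> {1..n}" "apply \<pi> ` D = {1..n}" "\<pi> * g * inverse \<pi> = g'"
    using cycle_type_on_eq_imp_conjugate[OF assms(2,4) _ g'(1)] g'(2) by auto
  have "coefficient t k {1..n} g' = coefficient t k D g"
    using coefficient_conjugate[OF assms(2,3) \<pi>(1) _ _ assms(1), of t g] assms(2,3) \<pi>(2,3) by simp
  then show ?thesis unfolding class_coefficient_def Let_def ng prod.case by simp
qed

lemma cycle_type_on_remove_fixed:
  assumes "finite D" "affected g \<subseteq> D - {a}" "a \<in> D"
  shows "cycle_type_on D g = add_mset 1 (cycle_type_on (D - {a}) g)"
  using cycle_type_on_insert_fixed[of "D - {a}" g a] assms by (simp add: insert_absorb)

text \<open>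
  Apply \<open>coefficient_Suc\<close> to an element \<open>a\<close> of a cycle of length \<open>p\<close>. With the whole set \<open>D\<close>, the \<open>j\<close>
  outside the cycle of \<open>a\<close> merge two cycles and give the first sum, and the \<open>j\<close> on the cycle of \<open>a\<close> cut it
  and give the second one. Dropping \<open>j\<close> contributes only if \<open>g (j a)\<close> fixes \<open>j\<close>, that is for \<open>j = g a\<close>;
  dropping \<open>a\<close> contributes only for \<open>j = g\<^sup>-\<^sup>1 a\<close>. Both shorten the cycle of \<open>a\<close> by one, with
  the factors \<open>1\<close> and \<open>1 - t\<close>, which add up to \<open>2 - t\<close>. Dropping \<open>j\<close> and \<open>a\<close> contributes only if \<open>g\<close>
  exchanges them.
\<close>

lemma class_coefficient_Suc:
  assumes k: "k \<ge> 1" and \<rho>: "add_mset p R \<in> partitions"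
  shows "class_coefficient t (Suc k) (add_mset p R) =
    (\<Sum>s\<in>#R. of_nat s * class_coefficient t k (add_mset (p + s) (R - {#s#})))
    + (\<Sum>i\<in>{1..<p}. class_coefficient t k (R + {#i, p - i#}))
    + (if p \<ge> 2 then (2 - t) * class_coefficient t k (add_mset (p - 1) R) else 0)
    + (if p = 2 then (1 - t) * class_coefficient t k R else 0)"
proof -
  let ?c = "class_coefficient t"
  obtain n g where g: "affected g \<subseteq> {1..n::nat}" "cycle_type_on {1..n} g = add_mset p R"
    using ex_perm_of_cycle_type[OF \<rho>] by blast
  define D where "D = {1..n}"
  have D: "finite D" "0 \<notin> D" "affected g \<subseteq> D" "cycle_type_on D g = add_mset p R"
    using g by (simp_all add: D_def)
  then obtain a where a: "a \<in> D" "Perm.order g a = p"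
    using in_cycle_type_onE[of D p g] by auto
  let ?O = "orbit g a" and ?h = "\<lambda>j. g * \<langle>j \<leftrightarrow> a\<rangle>"
  have u: "union_of_orbits g D" by (rule union_of_orbits_affected[OF D(3)])
  have O: "?O \<subseteq> D" using u a(1) by (auto simp: union_of_orbits_def)
  have R: "cycle_type_on (D - ?O) g = R"
    using cycle_type_on_remove_orbit[OF D(1) u a(1)] D(4) a(2) by simp
  have h: "affected (?h j) \<subseteq> D" if "j \<in> D" for j
    using affected_times_swap[OF D(3) that a(1)] .
  have c: "coefficient t k d f = ?c k (cycle_type_on d f)" if "d \<subseteq> D" "affected f \<subseteq> d" for d f
    using coefficient_eq_class_coefficient[OF k _ _ that(2)] that(1) D(1,2) finite_subset by blast
  have split: "cycle_type_on D (?h ((g ^ i) \<langle>$\<rangle> a)) = R + {#i, p - i#}" if "i \<in> {1..<p}" for i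
  proof -
    obtain R' where "cycle_type_on D g = R' + {#Perm.order g a#}"
      "cycle_type_on D (?h ((g ^ i) \<langle>$\<rangle> a)) = R' + {#i, Perm.order g a - i#}"
      using cycle_type_on_split[OF D(1,3) a(1), of i] \<open>i \<in> {1..<p}\<close> a(2) by auto
    then show ?thesis using D(4) a(2) by simp
  qed
  have ga: "g \<langle>$\<rangle> a \<noteq> a \<longleftrightarrow> p \<ge> 2"
    using order_greater_eq_two_iff[of g a] a(2) by (simp add: in_affected)
  have p_pos: "p > 0" using a(2) order_greater_zero[of g a] by simp
  (* The inverse image of a under g, as a power so that the split formula applies to it. *)
  define b where "b = (g ^ (p - 1)) \<langle>$\<rangle> a"
  have gb: "g \<langle>$\<rangle> b = a"
    using apply_power_order[of g a] p_pos
    by (cases p) (simp_all add: b_def a(2) apply_times)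
  have in_D: "(g ^ i) \<langle>$\<rangle> a \<in> D" for i using O by auto
  have gaD: "g \<langle>$\<rangle> a \<in> D" using in_D[of 1] by simp
  have bD: "b \<in> D" unfolding b_def by (rule in_D)
  have D_split: "D - {a} = (D - ?O) \<union> (?O - {a})" using O by auto

  have sum_merge: "(\<Sum>j\<in>D - ?O. coefficient t k D (?h j)) =
      (\<Sum>s\<in>#R. of_nat s * ?c k (add_mset (p + s) (R - {#s#})))"
  proof -
    have "coefficient t k D (?h j) = ?c k (add_mset (p + Perm.order g j) (R - {#Perm.order g j#}))"
      if j: "j \<in> D - ?O" for j
    proof -
      obtain R' where R': "cycle_type_on D g = R' + {#Perm.order g j, Perm.order g a#}"
        "cycle_type_on D (?h j) = R' + {#Perm.order g j + Perm.order g a#}"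
        using cycle_type_on_merge[OF D(1,3) _ a(1), of j] j by auto
      then have "R = add_mset (Perm.order g j) R'" using D(4) a(2) by simp
      then show ?thesis using R'(2) c[of D "?h j"] h[of j] j a(2) by (simp add: add.commute)
    qed
    then have "(\<Sum>j\<in>D - ?O. coefficient t k D (?h j)) =
        (\<Sum>j\<in>D - ?O. ?c k (add_mset (p + Perm.order g j) (R - {#Perm.order g j#})))"
      by (intro sum.cong) auto
    also have "\<dots> = (\<Sum>s\<in>#cycle_type_on (D - ?O) g. of_nat s * ?c k (add_mset (p + s) (R - {#s#})))"
      using D(1) union_of_orbits_Diff[OF u] by (intro sum_over_orbits) auto
    finally show ?thesis by (simp add: R)
  qed

  have bij: "bij_betw (\<lambda>i. (g ^ i) \<langle>$\<rangle> a) {1..<p} (?O - {a})"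
  proof -
    have "bij_betw (\<lambda>i. (g ^ i) \<langle>$\<rangle> a) ({..<p} - {0}) (?O - {a})"
    proof (rule bij_betw_DiffI)
      show "bij_betw (\<lambda>i. (g ^ i) \<langle>$\<rangle> a) {..<p} ?O"
        using inj_on_apply_range[of g a] by (simp add: bij_betw_def orbit_unfold_image[of g a] a(2))
    qed (use p_pos in auto)
    moreover have "{..<p} - {0} = {1..<p}" by auto
    ultimately show ?thesis by simp
  qed
  have sum_split: "(\<Sum>j\<in>?O - {a}. coefficient t k D (?h j)) = (\<Sum>i\<in>{1..<p}. ?c k (R + {#i, p - i#}))"
  proof -
    have "(\<Sum>j\<in>?O - {a}. coefficient t k D (?h j)) = (\<Sum>i\<in>{1..<p}. coefficient t k D (?h ((g ^ i) \<langle>$\<rangle> a)))"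
      by (rule sum.reindex_bij_betw[OF bij, symmetric])
    also have "\<dots> = (\<Sum>i\<in>{1..<p}. ?c k (R + {#i, p - i#}))"
      by (intro sum.cong refl) (subst c, simp_all add: h in_D split)
    finally show ?thesis .
  qed

  have drop_j: "coefficient t k (D - {j}) (?h j) = (if j = g \<langle>$\<rangle> a then ?c k (add_mset (p - 1) R) else 0)"
    if j: "j \<in> D - {a}" for j
  proof (cases "j = g \<langle>$\<rangle> a")
    case True
    then have p: "p \<ge> 2" using j ga by auto
    have "?h j \<langle>$\<rangle> j = j" using True by (simp add: apply_times)
    then have aff: "affected (?h j) \<subseteq> D - {j}" using h[of j] j by (auto simp: in_affected)
    have "cycle_type_on D (?h j) = R + {#1, p - 1#}" using split[of 1] p True by simp
    then have "cycle_type_on (D - {j}) (?h j) = add_mset (p - 1) R"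
      using cycle_type_on_remove_fixed[OF D(1) aff] j by simp
    then show ?thesis using True c[OF _ aff] by auto
  next
    case False
    then have "?h j \<langle>$\<rangle> j \<noteq> j" by (auto simp: apply_times)
    then have "\<not> affected (?h j) \<subseteq> D - {j}" by (auto simp: in_affected)
    from coefficient_eq_0[OF k this] show ?thesis using False by auto
  qed
  have drop_a: "coefficient t k (D - {a}) (?h j) = (if j = b then ?c k (add_mset (p - 1) R) else 0)"
    if j: "j \<in> D - {a}" for j
  proof (cases "j = b")
    case True
    then have p: "p \<ge> 2" using j p_pos by (cases "p = 1") (auto simp: b_def)
    have "?h j \<langle>$\<rangle> a = a" using True gb by (simp add: apply_times)
    then have aff: "affected (?h j) \<subseteq> D - {a}" using h[of j] j by (auto simp: in_affected)
    have "cycle_type_on D (?h j) = R + {#p - 1, 1#}" using split[of "p - 1"] p True by (simp add: b_def)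
    then have "cycle_type_on (D - {a}) (?h j) = add_mset (p - 1) R"
      using cycle_type_on_remove_fixed[OF D(1) aff a(1)] by simp
    then show ?thesis using True c[OF _ aff] by auto
  next
    case False
    then have "?h j \<langle>$\<rangle> a \<noteq> a" using gb by (metis apply_inj apply_times apply_swap_simp(2) comp_apply)
    then have "\<not> affected (?h j) \<subseteq> D - {a}" by (auto simp: in_affected)
    from coefficient_eq_0[OF k this] show ?thesis using False by auto
  qed
  have drop_ja: "coefficient t k (D - {j, a}) (?h j) = (if j = g \<langle>$\<rangle> a then if p = 2 then ?c k R else 0 else 0)"
    if j: "j \<in> D - {a}" for j
  proof (cases "j = g \<langle>$\<rangle> a \<and> p = 2")
    case True
    then have b: "b = j" by (simp add: b_def)
    have "?h j \<langle>$\<rangle> j = j" "?h j \<langle>$\<rangle> a = a" using True gb b by (simp_all add: apply_times)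
    then have aff: "affected (?h j) \<subseteq> D - {j} - {a}" using h[of j] j by (auto simp: in_affected)
    have "cycle_type_on D (?h j) = R + {#1, 1#}" using split[of 1] True by simp
    moreover have "cycle_type_on D (?h j) = add_mset 1 (add_mset 1 (cycle_type_on (D - {j} - {a}) (?h j)))"
      using cycle_type_on_remove_fixed[of D "?h j" j] cycle_type_on_remove_fixed[OF _ aff] aff D(1) a(1) j by auto
    moreover have "D - {j} - {a} = D - {j, a}" by auto
    ultimately show ?thesis using True c[OF _ aff] by auto
  next
    case False
    have "?h j \<langle>$\<rangle> j \<noteq> j \<or> ?h j \<langle>$\<rangle> a \<noteq> a"
    proof (rule ccontr)
      assume "\<not> ?thesis"
      then have 1: "g \<langle>$\<rangle> a = j" "g \<langle>$\<rangle> j = a" by (auto simp: apply_times)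
      then have "(g ^ 2) \<langle>$\<rangle> a = a" by (simp add: apply_times power2_eq_square)
      then have "p dvd 2" using a(2) by (simp add: apply_power_eq_self_iff)
      then have "p = 2" using ga 1 j by (auto dest!: dvd_imp_le)
      then show False using False 1 by auto
    qed
    then have "\<not> affected (?h j) \<subseteq> D - {j, a}" by (auto simp: in_affected)
    from coefficient_eq_0[OF k this] show ?thesis using False by auto
  qed

  have sum_j: "(\<Sum>j\<in>D - {a}. coefficient t k (D - {j}) (?h j)) = (if p \<ge> 2 then ?c k (add_mset (p - 1) R) else 0)"
    using D(1) ga gaD by (simp add: drop_j sum.delta')
  have b_ne: "b \<noteq> a \<longleftrightarrow> p \<ge> 2" using gb ga by (metis apply_inj)
  have sum_a: "(\<Sum>j\<in>D - {a}. coefficient t k (D - {a}) (?h j)) = (if p \<ge> 2 then ?c k (add_mset (p - 1) R) else 0)"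
    using D(1) b_ne bD by (simp add: drop_a sum.delta')
  have sum_ja: "(\<Sum>j\<in>D - {a}. coefficient t k (D - {j, a}) (?h j)) = (if p = 2 then ?c k R else 0)"
    using D(1) ga gaD by (simp add: drop_ja sum.delta')
  have "?c (Suc k) (add_mset p R) = coefficient t (Suc k) D g"
    using coefficient_eq_class_coefficient[of "Suc k" D g t] D by simp
  also have "\<dots> = (\<Sum>j\<in>D - {a}. coefficient t k D (?h j)) + (\<Sum>j\<in>D - {a}. coefficient t k (D - {j}) (?h j)) +
      (1 - t) * ((\<Sum>j\<in>D - {a}. coefficient t k (D - {a}) (?h j)) + (\<Sum>j\<in>D - {a}. coefficient t k (D - {j, a}) (?h j)))"
    by (simp only: coefficient_Suc[OF k D(1,2) a(1)] Let_def sum.distrib sum_distrib_left[symmetric])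
  also have "(\<Sum>j\<in>D - {a}. coefficient t k D (?h j)) =
      (\<Sum>j\<in>D - ?O. coefficient t k D (?h j)) + (\<Sum>j\<in>?O - {a}. coefficient t k D (?h j))"
    unfolding D_split using D(1) by (intro sum.union_disjoint) auto
  finally show ?thesis
    unfolding sum_merge sum_split sum_j sum_a sum_ja by (auto simp: algebra_simps)
qed

lemma cycle_type_on_swap: "a \<noteq> b \<Longrightarrow> cycle_type_on {a, b} \<langle>a \<leftrightarrow> b\<rangle> = {#2#}"
  using orbit_times_swap(1,2)[of a 1 b] by (simp add: cycle_type_on_def insert_commute del: card_orbit_eq)

lemma lifted_row_1: "lifted_row t 1 n = (\<Sum>m\<in>{1..n}. lifted_jm m)"
  by (induction n) (simp_all only: lifted_row_0 lifted_row_1_Suc order_refl, simp_all)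

lemma class_coefficient_1:
  assumes "\<rho> \<in> partitions"
  shows "class_coefficient t 1 \<rho> = (if \<rho> = {#2#} then 1 else 0)"
proof -
  have lookup: "Poly_Mapping.lookup (lifted_row t 1 n) (Partial_Perm D g) =
      (\<Sum>m\<in>{1..n}. \<Sum>j\<in>{1..<m}. 1 when transposition j m = Partial_Perm D g)" for n D g
    by (simp add: lifted_row_1[simplified] lifted_jm_def lookup_sum lookup_single)
  show ?thesis
  proof (cases "\<rho> = {#2#}")
    case True
    have "class_coefficient t 1 {#2#} = coefficient t 1 {1, 2} \<langle>1 \<leftrightarrow> 2\<rangle>"
      using coefficient_eq_class_coefficient[of 1 "{1, 2}" "\<langle>1 \<leftrightarrow> 2\<rangle>" t] by (simp add: cycle_type_on_swap affected_swap)
    also have "\<dots> = Poly_Mapping.lookup (lifted_row t 1 2) (Partial_Perm {1, 2} \<langle>1 \<leftrightarrow> 2\<rangle>)"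
      by (rule lookup_lifted_row[symmetric]) auto
    also have "\<dots> = 1"
    proof -
      have "{1..2::nat} = {1, 2}" "{1..<2::nat} = {1}" by auto
      then show ?thesis unfolding lookup by (simp add: transposition_def)
    qed
    finally show ?thesis using True by simp
  next
    case False
    obtain n g where g: "affected g \<subseteq> {1..n::nat}" "cycle_type_on {1..n} g = \<rho>"
      using ex_perm_of_cycle_type[OF assms] by blast
    have "class_coefficient t 1 \<rho> = coefficient t 1 {1..n} g"
      using coefficient_eq_class_coefficient[of 1 "{1..n}" g t] g by simp
    also have "\<dots> = Poly_Mapping.lookup (lifted_row t 1 n) (Partial_Perm {1..n} g)"
      by (rule lookup_lifted_row[symmetric]) auto
    also have "\<dots> = 0"
      unfolding lookup
    proof (intro sum.neutral ballI)
      fix m j assume "m \<in> {1..n}" "j \<in> {1..<m}"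
      then show "(1 when transposition j m = Partial_Perm {1..n} g) = 0"
        using cycle_type_on_swap[of j m] g(2) False by (auto simp: transposition_def when_def)
    qed
    finally show ?thesis using False by simp
  qed
qed

lemma class_coefficient_empty: "k \<ge> 1 \<Longrightarrow> class_coefficient t k {#} = 0"
  using coefficient_eq_class_coefficient[of k "{}" 1 t] lookup_lifted_row[of k "{}" 0 t 1]
  by (simp add: lifted_row_0)

lemma sum_mset_eq_sum_count:
  fixes f :: "'a \<Rightarrow> 'b::comm_semiring_1"
  assumes "finite S" "set_mset M \<subseteq> S"
  shows "(\<Sum>s\<in>#M. f s) = (\<Sum>s\<in>S. of_nat (count M s) * f s)"
  using assms(2)
proof (induction M)
  case (add x M)
  have "(\<Sum>s\<in>S. of_nat (count (add_mset x M) s) * f s) =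
      (\<Sum>s\<in>S. (if s = x then f s else 0) + of_nat (count M s) * f s)"
    by (intro sum.cong refl) (simp add: distrib_right)
  also have "\<dots> = f x + (\<Sum>s\<in>S. of_nat (count M s) * f s)"
    using assms(1) add.prems by (simp add: sum.distrib sum.delta')
  finally show ?case using add by simp
qed simp

lemma partition_subset: "\<rho> \<in> partitions \<Longrightarrow> set_mset \<rho> \<subseteq> {1..\<Sum>\<^sub># \<rho>}"
  by (auto simp: partitions_def Suc_le_eq dest!: multi_member_split intro: gr0I)

lemma raise_sum_eq:
  assumes "\<rho> \<in> partitions"
  shows "raise_sum f \<rho> = (\<Sum>r\<in>#\<rho>. of_nat r * f (add_mset (r + 1) (\<rho> - {#r#})))"
  unfolding raise_sum_def sum_mset_eq_sum_count[OF finite_atLeastAtMost partition_subset[OF assms]]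
  by (simp add: mult_ac)

text \<open>
  If \<open>r\<close> is a part of \<open>\<rho>\<close>, then \<open>m\<^sub>s(\<rho>) - \<delta>\<^sub>r\<^sub>s\<close> is the multiplicity of \<open>s\<close> in \<open>\<rho> \<setminus> (r)\<close>.
\<close>

lemma join_sum_eq:
  assumes "\<rho> \<in> partitions"
  shows "join_sum f \<rho> =
    (\<Sum>r\<in>#\<rho>. of_nat r * (\<Sum>s\<in>#\<rho> - {#r#}. of_nat s * f (add_mset (r + 1 + s) (\<rho> - {#r#} - {#s#}))))"
proof -
  let ?S = "{1..\<Sum>\<^sub># \<rho>}"
  note sub = partition_subset[OF assms]
  have "of_nat (r * s) * of_nat (count \<rho> r) * (of_nat (count \<rho> s) - (if r = s then 1 else 0)) * f (\<rho> - {#r, s#} + {#r + s + 1#}) =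
     of_nat (count \<rho> r) * (of_nat r * (of_nat (count (\<rho> - {#r#}) s) * (of_nat s * f (add_mset (r + 1 + s) (\<rho> - {#r#} - {#s#})))))"
    for r s
  proof (cases "r \<in># \<rho>")
    case True
    then have "(of_nat (count \<rho> s) - (if r = s then 1 else 0) :: rat poly) = of_nat (count (\<rho> - {#r#}) s)"
      by (auto simp: of_nat_diff Suc_le_eq)
    moreover have "\<rho> - {#r, s#} + {#r + s + 1#} = add_mset (r + 1 + s) (\<rho> - {#r#} - {#s#})"
      by (simp add: add_ac add_mset_commute)
    ultimately show ?thesis by (simp add: mult_ac)
  qed (simp add: count_eq_zero_iff[THEN iffD2])
  then have "join_sum f \<rho> = (\<Sum>r\<in>?S. of_nat (count \<rho> r) * (of_nat r * (\<Sum>s\<in>?S. of_nat (count (\<rho> - {#r#}) s)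
      * (of_nat s * f (add_mset (r + 1 + s) (\<rho> - {#r#} - {#s#}))))))"
    unfolding join_sum_def sum_distrib_left by (intro sum.cong refl)
  moreover have "set_mset (\<rho> - {#r#}) \<subseteq> ?S" for r using sub by (auto dest: in_diffD)
  ultimately show ?thesis
    by (simp only: sum_mset_eq_sum_count[OF finite_atLeastAtMost sub]
        sum_mset_eq_sum_count[OF finite_atLeastAtMost, symmetric])
qed

text \<open>
  The pairs \<open>(r, s)\<close> are grouped by \<open>q = r + s - 1\<close>, which has to be a part of \<open>\<rho>\<close>.
\<close>

lemma cut_sum_eq:
  assumes "\<rho> \<in> partitions"
  shows "cut_sum f \<rho> = (\<Sum>r\<in>#\<rho>. of_nat r * (\<Sum>i\<in>{1..r}. f (\<rho> - {#r#} + {#i, r + 1 - i#})))"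
proof -
  let ?S = "{1..\<Sum>\<^sub># \<rho>}"
  note sub = partition_subset[OF assms]
  let ?f = "\<lambda>(r, s). of_nat ((r + s - 1) * count \<rho> (r + s - 1)) * f (\<rho> - {#r + s - 1#} + {#r, s#})"
  let ?g = "\<lambda>(q, i). of_nat (count \<rho> q) * (of_nat q * f (\<rho> - {#q#} + {#i, q + 1 - i#}))"
  have "cut_sum f \<rho> = (\<Sum>x\<in>?S \<times> ?S. ?f x)"
    by (simp only: cut_sum_def sum.cartesian_product)
  also have "\<dots> = (\<Sum>x\<in>{x\<in>?S \<times> ?S. fst x + snd x - 1 \<in> ?S}. ?f x)"
  proof (intro sum.mono_neutral_right ballI)
    fix x assume "x \<in> ?S \<times> ?S - {x \<in> ?S \<times> ?S. fst x + snd x - 1 \<in> ?S}"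
    then have "fst x + snd x - 1 \<notin># \<rho>" using sub by blast
    then show "?f x = 0" by (simp add: case_prod_beta not_in_iff)
  qed auto
  also have "\<dots> = (\<Sum>x\<in>(SIGMA q:?S. {1..q}). ?g x)"
    by (rule sum.reindex_bij_witness[where i = "\<lambda>(q, i). (i, q + 1 - i)" and j = "\<lambda>(r, s). (r + s - 1, r)"])
      (auto simp: mult_ac)
  also have "\<dots> = (\<Sum>q\<in>?S. of_nat (count \<rho> q) * (of_nat q * (\<Sum>i\<in>{1..q}. f (\<rho> - {#q#} + {#i, q + 1 - i#}))))"
    by (subst sum.Sigma[symmetric]) (simp_all add: sum_distrib_left)
  finally show ?thesis
    by (simp only: sum_mset_eq_sum_count[OF finite_atLeastAtMost sub])
qed

lemma class_coefficient_recurrence_1: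
  assumes "k \<ge> 1" "\<rho> \<in> partitions"
  shows "class_coefficient t (Suc k) (add_mset 1 \<rho>) = raise_sum (class_coefficient t k) \<rho>"
  using class_coefficient_Suc[OF assms(1), of 1 \<rho> t] assms(2)
  by (simp add: raise_sum_eq partitions_def)

text \<open>
  The sum over \<open>r\<close>, weighted by \<open>r m\<^sub>r(\<rho>)\<close>, of \<open>class_coefficient_Suc\<close> for the part \<open>r + 1\<close> of
  \<open>\<rho> \<setminus> (r) \<union> (r + 1)\<close>. Shortening that part by one gives back \<open>\<rho>\<close>, and the weights add up to \<open>|\<rho>|\<close>.
\<close>

lemma class_coefficient_recurrence_2:
  assumes "k \<ge> 1" "\<rho> \<in> partitions"
  shows "raise_sum (class_coefficient t (Suc k)) \<rho> =
    (2 - t) * of_nat (\<Sum>\<^sub># \<rho>) * class_coefficient t k \<rho>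
    + (1 - t) * of_nat (count \<rho> 1) * class_coefficient t k (\<rho> - {#1#})
    + join_sum (class_coefficient t k) \<rho> + cut_sum (class_coefficient t k) \<rho>"
proof -
  let ?c = "class_coefficient t"
  let ?J = "\<lambda>r. \<Sum>s\<in>#\<rho> - {#r#}. of_nat s * ?c k (add_mset (r + 1 + s) (\<rho> - {#r#} - {#s#}))"
  let ?C = "\<lambda>r. \<Sum>i\<in>{1..r}. ?c k (\<rho> - {#r#} + {#i, r + 1 - i#})"
  let ?E = "\<lambda>r. if r = 1 then (1 - t) * ?c k (\<rho> - {#1#}) else 0"
  have "?c (Suc k) (add_mset (r + 1) (\<rho> - {#r#})) = ?J r + ?C r + (2 - t) * ?c k \<rho> + ?E r" if "r \<in># \<rho>" for r
  proof -
    have "r \<noteq> 0" using that assms(2) unfolding partitions_def by (metis mem_Collect_eq)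
    moreover have "add_mset (r + 1) (\<rho> - {#r#}) \<in> partitions"
      using assms(2) by (auto simp: partitions_def dest: in_diffD)
    moreover have "{1..<r + 1} = {1..r}" by auto
    ultimately show ?thesis
      using class_coefficient_Suc[OF assms(1), of "r + 1" "\<rho> - {#r#}" t] that by auto
  qed
  then have "raise_sum (?c (Suc k)) \<rho> = (\<Sum>r\<in>#\<rho>. of_nat r * (?J r + ?C r + (2 - t) * ?c k \<rho> + ?E r))"
    unfolding raise_sum_eq[OF assms(2)] by (intro arg_cong[where f = sum_mset] image_mset_cong) simp
  also have "\<dots> = (\<Sum>r\<in>#\<rho>. of_nat r * ?J r) + (\<Sum>r\<in>#\<rho>. of_nat r * ?C r)
      + (\<Sum>r\<in>#\<rho>. of_nat r * ((2 - t) * ?c k \<rho>)) + (\<Sum>r\<in>#\<rho>. of_nat r * ?E r)"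
    by (simp add: distrib_left sum_mset.distrib)
  also have "(\<Sum>r\<in>#\<rho>. of_nat r * ((2 - t) * ?c k \<rho>)) = (2 - t) * of_nat (\<Sum>\<^sub># \<rho>) * ?c k \<rho>"
  proof -
    have "(\<Sum>r\<in>#M. of_nat r * x) = of_nat (\<Sum>\<^sub># M) * x" for M and x :: "rat poly"
      by (induction M) (simp_all add: distrib_right)
    from this[of "(2 - t) * ?c k \<rho>" \<rho>] show ?thesis by (simp only: mult_ac)
  qed
  also have "(\<Sum>r\<in>#\<rho>. of_nat r * ?E r) = (1 - t) * of_nat (count \<rho> 1) * ?c k (\<rho> - {#1#})"
  proof -
    have "(\<Sum>r\<in>#M. of_nat r * (if r = 1 then x else 0)) = of_nat (count M 1) * x" for M and x :: "rat poly"
      by (induction M) (simp_all add: distrib_right)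
    then show ?thesis by (simp add: mult_ac)
  qed
  finally show ?thesis
    by (simp add: join_sum_eq[OF assms(2)] cut_sum_eq[OF assms(2)] add_ac)
qed

section \<open>Uniqueness of the family and the class expansion\<close>

lemma diff_in_partitions: "\<rho> \<in> partitions \<Longrightarrow> \<rho> - \<sigma> \<in> partitions"
  by (auto simp: partitions_def dest: in_diffD)

lemma add_mset_in_partitions_iff: "add_mset p \<rho> \<in> partitions \<longleftrightarrow> p \<noteq> 0 \<and> \<rho> \<in> partitions"
  by (auto simp: partitions_def)

lemma raise_sum_cong:
  assumes "\<rho> \<in> partitions" "\<And>\<sigma>. \<sigma> \<in> partitions \<Longrightarrow> f \<sigma> = g \<sigma>"
  shows "raise_sum f \<rho> = raise_sum g \<rho>"
  unfolding raise_sum_def using assms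
  by (intro sum.cong refl) (simp add: add_mset_in_partitions_iff diff_in_partitions)

lemma join_sum_cong:
  assumes "\<rho> \<in> partitions" "\<And>\<sigma>. \<sigma> \<in> partitions \<Longrightarrow> f \<sigma> = g \<sigma>"
  shows "join_sum f \<rho> = join_sum g \<rho>"
  unfolding join_sum_def using assms
  by (intro sum.cong refl) (simp add: add_mset_in_partitions_iff diff_in_partitions)

lemma cut_sum_cong:
  assumes "\<rho> \<in> partitions" "\<And>\<sigma>. \<sigma> \<in> partitions \<Longrightarrow> f \<sigma> = g \<sigma>"
  shows "cut_sum f \<rho> = cut_sum g \<rho>"
  unfolding cut_sum_def using assms
  by (intro sum.cong refl) (simp add: add_mset_in_partitions_iff diff_in_partitions)

text \<open>
  The inner induction is on an arbitrary part \<open>p\<close> of \<open>\<rho>\<close>. Raising in \<open>\<rho> \<setminus> (p + 1) \<union> (p)\<close> a part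
  other than \<open>p\<close> leaves a part \<open>p\<close>, so that the induction hypothesis covers all terms of the second
  recurrence except that of \<open>\<rho>\<close>.
\<close>

lemma content_recurrences_unique:
  assumes c: "content_recurrences c" and c': "content_recurrences c'"
    and "k \<ge> 1" "\<rho> \<in> partitions"
  shows "c k \<rho> = c' k \<rho>"
  using assms(3,4)
proof (induction k arbitrary: \<rho> rule: dec_induct)
  case base
  then show ?case using c c' by (simp add: content_recurrences_def)
next
  case (step k)
  then have k: "Suc k \<ge> 2" by simp
  have rec1: "d (Suc k) (add_mset 1 \<sigma>) = raise_sum (d k) \<sigma>"
    and rec2: "raise_sum (d (Suc k)) \<sigma> =
        (2 - [:0, 1:]) * of_nat (\<Sum>\<^sub># \<sigma>) * d k \<sigma>
        + (1 - [:0, 1:]) * of_nat (count \<sigma> 1) * d k (\<sigma> - {#1#})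
        + join_sum (d k) \<sigma> + cut_sum (d k) \<sigma>"
    if "content_recurrences d" "\<sigma> \<in> partitions" for d \<sigma>
  proof -
    have "\<forall>\<rho>\<in>partitions. d (Suc k) (\<rho> + {#1#}) = raise_sum (d (Suc k - 1)) \<rho> \<and>
        raise_sum (d (Suc k)) \<rho> =
          (2 - [:0, 1:]) * of_nat (\<Sum>\<^sub># \<rho>) * d (Suc k - 1) \<rho>
          + (1 - [:0, 1:]) * of_nat (count \<rho> 1) * d (Suc k - 1) (\<rho> - {#1#})
          + join_sum (d (Suc k - 1)) \<rho> + cut_sum (d (Suc k - 1)) \<rho>"
      using that(1) k unfolding content_recurrences_def by blast
    from bspec[OF this that(2)] show "d (Suc k) (add_mset 1 \<sigma>) = raise_sum (d k) \<sigma>"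
      "raise_sum (d (Suc k)) \<sigma> =
        (2 - [:0, 1:]) * of_nat (\<Sum>\<^sub># \<sigma>) * d k \<sigma>
        + (1 - [:0, 1:]) * of_nat (count \<sigma> 1) * d k (\<sigma> - {#1#})
        + join_sum (d k) \<sigma> + cut_sum (d k) \<sigma>"
      by simp_all
  qed
  have raise: "raise_sum (c k) \<sigma> = raise_sum (c' k) \<sigma>"
    and raise_Suc: "raise_sum (c (Suc k)) \<sigma> = raise_sum (c' (Suc k)) \<sigma>" if \<sigma>: "\<sigma> \<in> partitions" for \<sigma>
  proof -
    show "raise_sum (c k) \<sigma> = raise_sum (c' k) \<sigma>"
      using \<sigma> step.IH by (rule raise_sum_cong)
    have "\<sigma> - {#1#} \<in> partitions" using \<sigma> by (auto simp: partitions_def dest: in_diffD)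
    then show "raise_sum (c (Suc k)) \<sigma> = raise_sum (c' (Suc k)) \<sigma>"
      unfolding rec2[OF c \<sigma>] rec2[OF c' \<sigma>]
      using step.IH[of \<sigma>] step.IH[of "\<sigma> - {#1#}"] \<sigma>
        join_sum_cong[of \<sigma> "c k" "c' k"] cut_sum_cong[of \<sigma> "c k" "c' k"] step.IH by simp
  qed
  have "c (Suc k) \<rho> = c' (Suc k) \<rho>" if "p \<ge> 1" "p \<in># \<rho>" "\<rho> \<in> partitions" for p \<rho>
    using that
  proof (induction p arbitrary: \<rho> rule: dec_induct)
    case base
    then have "\<rho> - {#1#} \<in> partitions" "\<rho> = add_mset 1 (\<rho> - {#1#})"
      by (auto simp: partitions_def dest: in_diffD)
    then show ?case using rec1[OF c] rec1[OF c'] raise by metis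
  next
    case (step p)
    define \<sigma> where "\<sigma> = add_mset p (\<rho> - {#Suc p#})"
    have \<sigma>: "\<sigma> \<in> partitions" "add_mset (p + 1) (\<sigma> - {#p#}) = \<rho>"
      using step by (auto simp: \<sigma>_def partitions_def dest: in_diffD)
    have other: "add_mset (r + 1) (\<sigma> - {#r#}) \<in> partitions" "p \<in># add_mset (r + 1) (\<sigma> - {#r#})" if "r \<noteq> p" for r
      using \<sigma>(1) that by (simp_all add: add_mset_in_partitions_iff diff_in_partitions) (simp add: \<sigma>_def)
    let ?S = "{1..\<Sum>\<^sub># \<sigma>}"
    let ?f = "\<lambda>d r. of_nat (r * count \<sigma> r) * d (Suc k) (\<sigma> - {#r#} + {#r + 1#})"
    have "p \<in> ?S" using partition_subset[OF \<sigma>(1)] by (auto simp: \<sigma>_def)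
    then have remove: "raise_sum (d (Suc k)) \<sigma> = ?f d p + sum (?f d) (?S - {p})" for d
      unfolding raise_sum_def by (intro sum.remove) auto
    have "sum (?f c) (?S - {p}) = sum (?f c') (?S - {p})"
      using step.IH[OF other(2,1)] by (intro sum.cong refl) simp
    then have "?f c p = ?f c' p"
      using raise_Suc[OF \<sigma>(1)] unfolding remove by simp
    moreover have "p * count \<sigma> p \<noteq> 0" using step by (simp add: \<sigma>_def)
    ultimately show ?case using \<sigma>(2) by (auto simp: count_eq_zero_iff)
  qed
  moreover have "c (Suc k) {#} = 0" "c' (Suc k) {#} = 0"
    using c c' by (simp_all add: content_recurrences_def)
  moreover have "p \<ge> 1" if "p \<in># \<rho>" for p
    using that step.prems by (cases "p = 0") (auto simp: partitions_def)
  ultimately show ?case using step.prems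
    by (cases "\<rho> = {#}") (auto elim!: multiset_nonemptyE)
qed

definition content_family :: "nat \<Rightarrow> nat multiset \<Rightarrow> rat poly"
  where "content_family = (\<lambda>k\<in>{1..}. \<lambda>\<rho>\<in>partitions. class_coefficient [:0, 1:] k \<rho>)"

lemma content_family_eq:
  "k \<ge> 1 \<Longrightarrow> \<rho> \<in> partitions \<Longrightarrow> content_family k \<rho> = class_coefficient [:0, 1:] k \<rho>"
  by (simp add: content_family_def)

lemma content_recurrences_content_family: "content_recurrences content_family"
  unfolding content_recurrences_def
proof (intro conjI ballI allI impI)
  fix \<rho> :: "nat multiset" assume "\<rho> \<in> partitions"
  then show "content_family 1 \<rho> = (if \<rho> = {#2#} then 1 else 0)"
    by (simp only: content_family_eq[OF order_refl] class_coefficient_1)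
next
  fix k :: nat assume "k \<ge> 1"
  then show "content_family k {#} = 0"
    by (simp add: content_family_eq partitions_def class_coefficient_empty)
next
  fix k :: nat and \<rho> :: "nat multiset" assume k: "2 \<le> k" and \<rho>: "\<rho> \<in> partitions"
  define j where "j = k - 1"
  have j: "k = Suc j" "k - 1 = j" "1 \<le> j" "1 \<le> Suc j" using k by (auto simp: j_def)
  have eq: "content_family j \<sigma> = class_coefficient [:0, 1:] j \<sigma>"
    "content_family (Suc j) \<sigma> = class_coefficient [:0, 1:] (Suc j) \<sigma>" if "\<sigma> \<in> partitions" for \<sigma>
    using that j by (simp_all add: content_family_eq)
  have \<rho>': "add_mset 1 \<rho> \<in> partitions" "\<rho> - {#1#} \<in> partitions"
    using \<rho> by (auto simp: partitions_def dest: in_diffD)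
  have raise: "raise_sum (content_family j) \<rho> = raise_sum (class_coefficient [:0, 1:] j) \<rho>"
      "raise_sum (content_family (Suc j)) \<rho> = raise_sum (class_coefficient [:0, 1:] (Suc j)) \<rho>"
    and join: "join_sum (content_family j) \<rho> = join_sum (class_coefficient [:0, 1:] j) \<rho>"
    and cut: "cut_sum (content_family j) \<rho> = cut_sum (class_coefficient [:0, 1:] j) \<rho>"
    by (rule raise_sum_cong[OF \<rho>] join_sum_cong[OF \<rho>] cut_sum_cong[OF \<rho>], erule eq)+
  show "content_family k (\<rho> + {#1#}) = raise_sum (content_family (k - 1)) \<rho>"
    using class_coefficient_recurrence_1[OF j(3) \<rho>, of "[:0, 1:]"] raise(1) eq(2)[OF \<rho>'(1)]
    by (simp add: j(1))
  show "raise_sum (content_family k) \<rho> =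
      (2 - [:0, 1:]) * of_nat (\<Sum>\<^sub># \<rho>) * content_family (k - 1) \<rho>
      + (1 - [:0, 1:]) * of_nat (count \<rho> 1) * content_family (k - 1) (\<rho> - {#1#})
      + join_sum (content_family (k - 1)) \<rho> + cut_sum (content_family (k - 1)) \<rho>"
    unfolding j(2) unfolding j(1) raise(2) join cut eq(1)[OF \<rho>] eq(1)[OF \<rho>'(2)]
    by (rule class_coefficient_recurrence_2[OF j(3) \<rho>])
qed

lemma content_families_eq: "content_families = {content_family}"
proof
  show "{content_family} \<subseteq> content_families"
    using content_recurrences_content_family by (auto simp: content_families_def content_family_def)
  show "content_families \<subseteq> {content_family}"
  proof
    fix c assume "c \<in> content_families"
    then have c: "c \<in> {1..} \<rightarrow>\<^sub>E (partitions \<rightarrow>\<^sub>E UNIV)" "content_recurrences c"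
      by (auto simp: content_families_def)
    have "c k \<rho> = content_family k \<rho>" for k \<rho>
    proof (cases "k \<ge> 1")
      case True
      show ?thesis
      proof (cases "\<rho> \<in> partitions")
        case \<rho>: True
        show ?thesis
          by (rule content_recurrences_unique[OF c(2) content_recurrences_content_family True \<rho>])
      next
        case False
        have "c k \<in> partitions \<rightarrow>\<^sub>E UNIV" using PiE_mem[OF c(1), of k] True by simp
        then have "c k \<rho> = undefined" using False by (rule PiE_arb)
        then show ?thesis using False True by (simp add: content_family_def)
      qed
    next
      case False
      then have "k \<notin> {1..}" by simp
      then show ?thesis using PiE_arb[OF c(1)] by (simp add: content_family_def del: atLeast_iff)
    qed
    then show "c \<in> {content_family}" by auto
  qed
qed

lemma cycle_type_on_superset:
  assumes "finite E" "affected g \<subseteq> D" "D \<subseteq> E"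
  shows "cycle_type_on E g = cycle_type_on D g + replicate_mset (card E - card D) 1"
proof -
  have D: "finite D" using assms finite_subset by blast
  have "cycle_type_on (D \<union> F) g = cycle_type_on D g + replicate_mset (card F) 1" if "finite F" "D \<inter> F = {}" for F
    using that
  proof (induction F)
    case (insert a F)
    then have "cycle_type_on (insert a (D \<union> F)) g = add_mset 1 (cycle_type_on (D \<union> F) g)"
      using D assms(2) by (intro cycle_type_on_insert_fixed) auto
    then show ?case using insert by simp
  qed simp
  from this[of "E - D"] show ?thesis
    using assms D by (simp add: Un_absorb1 card_Diff_subset)
qed

lemma card_subsets_between:
  assumes "finite E" "A \<subseteq> E" "card A \<le> m"
  shows "card {d. A \<subseteq> d \<and> d \<subseteq> E \<and> card d = m} = (card E - card A) choose (m - card A)"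
proof -
  have A: "finite A" using assms finite_subset by blast
  have "bij_betw (\<lambda>F. A \<union> F) {F. F \<subseteq> E - A \<and> card F = m - card A} {d. A \<subseteq> d \<and> d \<subseteq> E \<and> card d = m}"
  proof (rule bij_betw_byWitness[where f' = "\<lambda>d. d - A"])
    show "(\<lambda>F. A \<union> F) ` {F. F \<subseteq> E - A \<and> card F = m - card A} \<subseteq> {d. A \<subseteq> d \<and> d \<subseteq> E \<and> card d = m}"
    proof (intro image_subsetI CollectI conjI)
      fix F assume F: "F \<in> {F. F \<subseteq> E - A \<and> card F = m - card A}"
      then have "finite F" "A \<inter> F = {}" using assms(1) finite_subset by auto
      then show "card (A \<union> F) = m" using A F assms(3) by (simp add: card_Un_disjoint)
    qed (use assms in auto)
    show "(\<lambda>d. d - A) ` {d. A \<subseteq> d \<and> d \<subseteq> E \<and> card d = m} \<subseteq> {F. F \<subseteq> E - A \<and> card F = m - card A}"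
      using A by (auto simp: card_Diff_subset)
  qed auto
  then show ?thesis
    using bij_betw_same_card n_subsets[of "E - A" "m - card A"] assms A by (fastforce simp: card_Diff_subset)
qed

lemma sum_mset_filter_ne_1:
  "\<Sum>\<^sub># \<rho> = \<Sum>\<^sub># (filter_mset (\<lambda>p. p \<noteq> 1) \<rho>) + count \<rho> 1"
  by (induction \<rho>) auto

text \<open>
  Enlarging \<open>d\<close> adds parts \<open>1\<close> to the cycle type. So, if \<open>g\<close> has the cycle type of the class sum of \<open>\<rho>\<close>,
  it has type \<open>\<rho>\<close> on \<open>d\<close> exactly when \<open>d\<close> has \<open>|\<rho>|\<close> elements: besides the points moved by \<open>g\<close>, whose
  number is the sum of the parts of \<open>\<rho>\<close> different from \<open>1\<close>, it contains \<open>m\<^sub>1(\<rho>)\<close> of the fixed points.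
\<close>

lemma card_supports_of_type:
  assumes g: "affected g \<subseteq> {1..n}" and \<rho>: "\<rho> \<in> partitions" "\<Sum>\<^sub># \<rho> \<le> n"
  shows "card {d. affected g \<subseteq> d \<and> d \<subseteq> {1..n} \<and> cycle_type_on d g = \<rho>} =
    (if cycle_type n g = \<rho> + replicate_mset (n - \<Sum>\<^sub># \<rho>) 1
     then (n - \<Sum>\<^sub># (filter_mset (\<lambda>p. p \<noteq> 1) \<rho>)) choose count \<rho> 1 else 0)"
proof -
  let ?A = "affected g"
  have type: "cycle_type n g = cycle_type_on d g + replicate_mset (n - card d) 1"
    and card: "\<Sum>\<^sub># (cycle_type_on d g) = card d" if "?A \<subseteq> d" "d \<subseteq> {1..n}" for d
    using cycle_type_on_superset[of "{1..n}" g d] that finite_subset[OF that(2)]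
      sum_mset_cycle_type_on[OF _ union_of_orbits_affected[OF that(1)]]
    by (simp_all add: cycle_type_eq)
  show ?thesis
  proof (cases "cycle_type n g = \<rho> + replicate_mset (n - \<Sum>\<^sub># \<rho>) 1")
    case True
    have iff: "cycle_type_on d g = \<rho> \<longleftrightarrow> card d = \<Sum>\<^sub># \<rho>" if "?A \<subseteq> d" "d \<subseteq> {1..n}" for d
      using type[OF that] card[OF that] True by auto
    have "p \<noteq> 1" if p: "p \<in># cycle_type_on ?A g" for p
    proof -
      obtain a where "a \<in> affected g" "p = Perm.order g a"
        using in_cycle_type_onE[OF finite_affected p] by blast
      then show ?thesis using affected_order_greater_eq_two[of a g] by simp
    qed
    then have "filter_mset (\<lambda>p. p \<noteq> 1) (cycle_type_on ?A g) = cycle_type_on ?A g"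
      by (simp add: filter_mset_eq_conv)
    moreover have "filter_mset (\<lambda>p. p \<noteq> 1) (\<sigma> + replicate_mset m 1) = filter_mset (\<lambda>p. p \<noteq> 1) \<sigma>" for \<sigma> :: "nat multiset" and m
      by (induction m) auto
    ultimately have "filter_mset (\<lambda>p. p \<noteq> 1) \<rho> = cycle_type_on ?A g"
      using type[OF subset_refl g] True by metis
    then have A: "\<Sum>\<^sub># (filter_mset (\<lambda>p. p \<noteq> 1) \<rho>) = card ?A" using card[OF subset_refl g] by simp
    have \<rho>_sum: "\<Sum>\<^sub># \<rho> = card ?A + count \<rho> 1" using sum_mset_filter_ne_1[of \<rho>] A by simp
    have "{d. ?A \<subseteq> d \<and> d \<subseteq> {1..n} \<and> cycle_type_on d g = \<rho>} = {d. ?A \<subseteq> d \<and> d \<subseteq> {1..n} \<and> card d = \<Sum>\<^sub># \<rho>}"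
      using iff by blast
    then show ?thesis
      using card_subsets_between[OF _ g, of "\<Sum>\<^sub># \<rho>"] True \<rho>_sum A by simp
  next
    case False
    have "{d. ?A \<subseteq> d \<and> d \<subseteq> {1..n} \<and> cycle_type_on d g = \<rho>} = {}"
      using type card False by force
    then show ?thesis using False by simp
  qed
qed

fun underlying_perm :: "partial_perm \<Rightarrow> nat perm"
  where "underlying_perm (Partial_Perm d g) = g"

lemma underlying_perm_add: "underlying_perm (a + b) = underlying_perm a + underlying_perm b"
  by (cases a; cases b) (simp add: plus_perm_def)

lemma finite_symm_group: "finite (symm_group n)"
proof (rule finite_imageD)
  have "g \<langle>$\<rangle> x \<in> {1..n}" if "g \<in> symm_group n" "x \<in> {1..n}" for g x
    using that union_of_orbits_affected[of g "{1..n}"] apply_self_in_orbit[of g x]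
    unfolding symm_group_def union_of_orbits_def by blast
  then have "(\<lambda>g. restrict (apply g) {1..n}) ` symm_group n \<subseteq> {1..n} \<rightarrow>\<^sub>E {1..n}"
    by (intro image_subsetI restrict_PiE_iff[THEN iffD2] ballI)
  then show "finite ((\<lambda>g. restrict (apply g) {1..n}) ` symm_group n)"
    by (rule finite_subset) (simp add: finite_PiE)
  show "inj_on (\<lambda>g. restrict (apply g) {1..n}) (symm_group n)"
  proof (rule inj_onI, rule perm_eqI)
    fix g h x
    assume "g \<in> symm_group n" "h \<in> symm_group n" and eq: "restrict (apply g) {1..n} = restrict (apply h) {1..n}"
    then have "x \<notin> {1..n} \<Longrightarrow> x \<notin> affected g \<and> x \<notin> affected h"
      unfolding symm_group_def by blast
    then show "g \<langle>$\<rangle> x = h \<langle>$\<rangle> x"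
      using fun_cong[OF eq, of x] by (cases "x \<in> {1..n}") (simp_all add: in_affected)
  qed
qed

lemma lookup_class_sum:
  "Poly_Mapping.lookup (class_sum n \<mu>) g = (if g \<in> symm_group n \<and> cycle_type n g = \<mu> then 1 else 0)"
proof -
  have "finite {p. p \<in> symm_group n \<and> cycle_type n p = \<mu>}"
    using finite_symm_group by simp
  then show ?thesis
    by (simp add: class_sum_def lookup_sum group_elem_def lookup_single when_def sum.delta)
qed

text \<open>
  The image of the lifted polynomial under the homomorphism that forgets the sets and applies \<open>\<phi>\<close> to the
  scalars; \<open>\<phi>\<close> will be the inclusion of the rational into the complex polynomials.
\<close>

lemma hall_littlewood_row_expansion:
  fixes \<phi> :: "rat poly \<Rightarrow> 'b::comm_ring_1"
  assumes add: "\<And>a b. \<phi> (a + b) = \<phi> a + \<phi> b" and mult: "\<And>a b. \<phi> (a * b) = \<phi> a * \<phi> b" and one: "\<phi> 1 = 1"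
    and k: "k \<ge> 1"
  shows "hall_littlewood_row k (map jucys_murphy [1..<n + 1]) (scalar (\<phi> t)) =
    (\<Sum>\<rho> | \<rho> \<in> partitions \<and> \<Sum>\<^sub># \<rho> \<le> n.
      scalar (\<phi> (class_coefficient t k \<rho>) * of_nat ((n - \<Sum>\<^sub># (filter_mset (\<lambda>p. p \<noteq> 1) \<rho>)) choose count \<rho> 1))
        * class_sum n (\<rho> + replicate_mset (n - \<Sum>\<^sub># \<rho>) 1))"
    (is "_ = ?rhs")
proof (rule poly_mapping_eqI)
  fix g :: "nat perm"
  let ?F = "push_forward underlying_perm \<phi>"
  let ?D = "{d. affected g \<subseteq> d \<and> d \<subseteq> {1..n}}"
  let ?M = "{\<rho> \<in> partitions. \<Sum>\<^sub># \<rho> \<le> n}"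
  have 0: "underlying_perm 0 = 0" by (simp add: zero_partial_perm_def zero_perm_def)
  have "?F (lifted_jm m) = jucys_murphy m" for m
    by (simp add: lifted_jm_def jucys_murphy_def group_elem_def transposition_def push_forward_sum[OF add]
        push_forward_single[OF add] one)
  then have "hall_littlewood_row k (map jucys_murphy [1..<n + 1]) (scalar (\<phi> t)) = ?F (lifted_row t k n)"
    unfolding lifted_row_def scalar_def
    using hall_littlewood_row_hom[of ?F k "map lifted_jm [1..<n + 1]" "Poly_Mapping.single 0 t",
        OF push_forward_0[OF add] push_forward_add[OF add] push_forward_diff[OF add]
          push_forward_mult[OF add mult underlying_perm_add] k]
    by (simp add: push_forward_single[OF add] 0 comp_def del: upt_Suc)
  then have "Poly_Mapping.lookup (hall_littlewood_row k (map jucys_murphy [1..<n + 1]) (scalar (\<phi> t))) g =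
      (\<Sum>a\<in>(\<lambda>d. Partial_Perm d g) ` ?D. \<phi> (Poly_Mapping.lookup (lifted_row t k n) a))"
  proof (simp only:, intro lookup_push_forward[OF add])
    fix a assume a: "underlying_perm a = g" "Poly_Mapping.lookup (lifted_row t k n) a \<noteq> 0"
    obtain d where d: "a = Partial_Perm d g" using a(1) by (cases a) auto
    then have "d \<in> ?D" using a(2) lookup_lifted_row_eq_0[OF k, of g d n t] by auto
    then show "a \<in> (\<lambda>d. Partial_Perm d g) ` ?D" using d by (rule rev_image_eqI)
  qed auto
  also have "\<dots> = (\<Sum>d\<in>?D. \<phi> (Poly_Mapping.lookup (lifted_row t k n) (Partial_Perm d g)))"
    by (subst sum.reindex) (auto simp: inj_on_def)
  also have "\<dots> = (\<Sum>d\<in>?D. \<phi> (class_coefficient t k (cycle_type_on d g)))"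
  proof (rule sum.cong[OF refl])
    fix d assume d: "d \<in> ?D"
    then have "finite d" "0 \<notin> d" using finite_subset by auto
    then show "\<phi> (Poly_Mapping.lookup (lifted_row t k n) (Partial_Perm d g)) =
        \<phi> (class_coefficient t k (cycle_type_on d g))"
      using d by (simp add: lookup_lifted_row[OF k] coefficient_eq_class_coefficient[OF k])
  qed
  also have "\<dots> = (\<Sum>\<rho>\<in>?M. \<Sum>d | d \<in> ?D \<and> cycle_type_on d g = \<rho>. \<phi> (class_coefficient t k (cycle_type_on d g)))"
  proof (rule sum.group[symmetric])
    show "finite ?D" by (rule finite_subset[of _ "Pow {1..n}"]) auto
    show "finite ?M" by (rule finite_partitions_le)
    show "(\<lambda>d. cycle_type_on d g) ` ?D \<subseteq> ?M"
    proof (intro image_subsetI CollectI conjI)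
      fix d assume d: "d \<in> ?D"
      then have fin: "finite d" using finite_subset by auto
      then show "cycle_type_on d g \<in> partitions" by (rule cycle_type_on_partition)
      show "\<Sum>\<^sub># (cycle_type_on d g) \<le> n"
        using sum_mset_cycle_type_on[OF fin union_of_orbits_affected] d card_mono[of "{1..n}" d] by simp
    qed
  qed
  also have "\<dots> = (\<Sum>\<rho>\<in>?M. of_nat (card {d. affected g \<subseteq> d \<and> d \<subseteq> {1..n} \<and> cycle_type_on d g = \<rho>}) * \<phi> (class_coefficient t k \<rho>))"
    by (intro sum.cong refl) (simp add: conj_assoc)
  also have "\<dots> = Poly_Mapping.lookup ?rhs g"
    unfolding lookup_sum scalar_def lookup_single_0_times lookup_class_sum
  proof (rule sum.cong[OF refl])
    fix \<rho> assume \<rho>: "\<rho> \<in> ?M"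
    show "of_nat (card {d. affected g \<subseteq> d \<and> d \<subseteq> {1..n} \<and> cycle_type_on d g = \<rho>}) * \<phi> (class_coefficient t k \<rho>) =
      \<phi> (class_coefficient t k \<rho>) * of_nat ((n - \<Sum>\<^sub># (filter_mset (\<lambda>p. p \<noteq> 1) \<rho>)) choose count \<rho> 1) *
      (if g \<in> symm_group n \<and> cycle_type n g = \<rho> + replicate_mset (n - \<Sum>\<^sub># \<rho>) 1 then 1 else 0)"
    proof (cases "affected g \<subseteq> {1..n}")
      case True
      then show ?thesis using \<rho> card_supports_of_type[OF True, of \<rho>] by (simp add: symm_group_def)
    next
      case False
      then have "{d. affected g \<subseteq> d \<and> d \<subseteq> {1..n} \<and> cycle_type_on d g = \<rho>} = {}" by blast
      then show ?thesis using False by (simp only: symm_group_def) simp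
    qed
  qed
  finally show "Poly_Mapping.lookup (hall_littlewood_row k (map jucys_murphy [1..<n + 1]) (scalar (\<phi> t))) g =
    Poly_Mapping.lookup ?rhs g" .
qed

lemma map_poly_of_rat_add:
  "map_poly of_rat (p + q) = (map_poly of_rat p + map_poly of_rat q :: 'a::field_char_0 poly)"
  by (rule poly_eqI) (simp add: coeff_map_poly of_rat_add)

lemma map_poly_of_rat_mult:
  "map_poly of_rat (p * q) = (map_poly of_rat p * map_poly of_rat q :: 'a::field_char_0 poly)"
  by (rule poly_eqI) (simp add: coeff_map_poly coeff_mult of_rat_sum of_rat_mult)

theorem theorem8p1:
  shows "(\<exists>!c. c \<in> content_families) \<and>
    (\<forall>c\<in>content_families. \<forall>k\<ge>1. \<forall>n\<ge>1.
      hall_littlewood_row k (map jucys_murphy [1..<n + 1]) (scalar [:0, 1:]) =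
      (\<Sum>\<rho> | \<rho> \<in> partitions \<and> \<Sum>\<^sub># \<rho> \<le> n.
        scalar (map_poly of_rat (c k \<rho>)
                * of_nat ((n - \<Sum>\<^sub># (filter_mset (\<lambda>p. p \<noteq> 1) \<rho>)) choose count \<rho> 1))
          * (class_sum n (\<rho> + replicate_mset (n - \<Sum>\<^sub># \<rho>) 1) :: complex poly sym_algebra)))"
proof -
  have z: "map_poly of_rat [:0, 1:] = ([:0, 1:] :: complex poly)"
    by (simp add: map_poly_pCons)
  have expansion: "hall_littlewood_row k (map jucys_murphy [1..<n + 1]) (scalar [:0, 1:]) =
      (\<Sum>\<rho> | \<rho> \<in> partitions \<and> \<Sum>\<^sub># \<rho> \<le> n.
        scalar (map_poly of_rat (content_family k \<rho>)
                * of_nat ((n - \<Sum>\<^sub># (filter_mset (\<lambda>p. p \<noteq> 1) \<rho>)) choose count \<rho> 1))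
          * (class_sum n (\<rho> + replicate_mset (n - \<Sum>\<^sub># \<rho>) 1) :: complex poly sym_algebra))"
    if "k \<ge> 1" for k n
  proof -
    note hall_littlewood_row_expansion[where \<phi> = "map_poly of_rat :: rat poly \<Rightarrow> complex poly" and t = "[:0, 1:]",
      OF map_poly_of_rat_add map_poly_of_rat_mult map_poly_1' that, of n, unfolded z]
    also have "(\<Sum>\<rho> | \<rho> \<in> partitions \<and> \<Sum>\<^sub># \<rho> \<le> n.
        scalar (map_poly of_rat (class_coefficient [:0, 1:] k \<rho>)
                * of_nat ((n - \<Sum>\<^sub># (filter_mset (\<lambda>p. p \<noteq> 1) \<rho>)) choose count \<rho> 1))
          * (class_sum n (\<rho> + replicate_mset (n - \<Sum>\<^sub># \<rho>) 1) :: complex poly sym_algebra)) =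
      (\<Sum>\<rho> | \<rho> \<in> partitions \<and> \<Sum>\<^sub># \<rho> \<le> n.
        scalar (map_poly of_rat (content_family k \<rho>)
                * of_nat ((n - \<Sum>\<^sub># (filter_mset (\<lambda>p. p \<noteq> 1) \<rho>)) choose count \<rho> 1))
          * class_sum n (\<rho> + replicate_mset (n - \<Sum>\<^sub># \<rho>) 1))"
      by (intro sum.cong refl) (simp add: content_family_eq[OF that])
    finally show ?thesis by simp
  qed
  show ?thesis
  proof (intro conjI ballI allI impI)
    show "\<exists>!c. c \<in> content_families" by (simp add: content_families_eq)
  next
    fix c and k n :: nat assume "c \<in> content_families" "k \<ge> 1"
    then show "hall_littlewood_row k (map jucys_murphy [1..<n + 1]) (scalar [:0, 1:]) =
      (\<Sum>\<rho> | \<rho> \<in> partitions \<and> \<Sum>\<^sub># \<rho> \<le> n.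
        scalar (map_poly of_rat (c k \<rho>)
                * of_nat ((n - \<Sum>\<^sub># (filter_mset (\<lambda>p. p \<noteq> 1) \<rho>)) choose count \<rho> 1))
          * (class_sum n (\<rho> + replicate_mset (n - \<Sum>\<^sub># \<rho>) 1) :: complex poly sym_algebra))"
      unfolding content_families_eq singleton_iff using expansion by (simp only:)
  qed
qed

end
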